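(* Let $\alpha\in\mathbb{R}$, $0<p<\infty$, and let $X$ be a ball Banach function space on $\mathbb{R}^n$ such that $X'=X^*$, the Hardy–Littlewood maximal operator $M$ is bounded on $X$, and $-n\delta_X<\alpha<n\delta_{X'}$. Then $M$ is bounded on $\dot{K}^{\alpha,p}_X(\mathbb{R}^n)$.
   Context: $\mathcal{M}(\mathbb{R}^n)$ denotes the Lebesgue measurable functions on $\mathbb{R}^n$. A ball quasi-Banach function space is a quasi-Banach space $X\subseteq\mathcal{M}(\mathbb{R}^n)$ such that: (i) $\|f\|_X=0$ implies $f=0$ a.e.; (ii) $|g|\le|f|$ a.e. implies $\|g\|_X\le\|f\|_X$; (iii) $0\le f_m\uparrow f$ a.e. implies $\|f_m\|_X\uparrow\|f\|_X$; (iv) $\chi_B\in X$ for every ball $B\subset\mathbb{R}^n$. It is a ball Banach function space if moreover $\|f+g\|_X\le\|f\|_X+\|g\|_X$ for all $f,g\in X$ and, for every ball $B$, there is $C(B)>0$ with $\int_B|f(x)|\,dx\le C(B)\|f\|_X$ for all $f\in X$. The associate space of a ball Banach function space $X$ is $X'=\{f\in\mathcal{M}(\mathbb{R}^n):\|f\|_{X'}=\sup_{\|g\|_X\le 1}\|fg\|_{L^1(\mathbb{R}^n)}<\infty\}$; it is again a ball Banach function space. $X'=X^*$ means that the topological dual of $X$ is identified with $X'$ via the pairing $\int fg$. For a ball Banach function space $Y$, $\delta_Y$ denotes a constant with $0<\delta_Y<1$ for which there is $C>0$ such that $\|\chi_E\|_Y/\|\chi_B\|_Y\le C(|E|/|B|)^{\delta_Y}$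 for all balls $B$ and all measurable $E\subseteq B$ (such a constant exists whenever $M$ is bounded on $Y'$); the use of $\delta_X,\delta_{X'}$ in the statement includes that such constants exist and are fixed. $M(f)(x)=\sup_{B\ni x}\frac1{|B|}\int_B|f(y)|\,dy$, the supremum over all balls $B$ containing $x$. For $k\in\mathbb{Z}$ let $B_k=\{x:|x|<2^k\}$, $C_k=B_k\setminus B_{k-1}$, $\chi_k=\chi_{C_k}$. $L^X_{\rm loc}(\mathbb{R}^n\setminus\{0\})$ is the set of measurable $f$ with $f\chi_F\in X$ for every compact $F\subseteq\mathbb{R}^n\setminus\{0\}$. The homogeneous Herz-type space is $$\dot{K}^{\alpha,p}_X(\mathbb{R}^n)=\Big\{f\in L^X_{\rm loc}(\mathbb{R}^n\setminus\{0\}):\|f\|_{\dot{K}^{\alpha,p}_X}=\Big(\sum_{k\in\mathbb{Z}}2^{kp\alpha}\|f\chi_k\|_X^p\Big)^{1/p}<\infty\Big\}.$$ *)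

theory Defs
  imports "HOL-Analysis.Analysis"
begin

text \<open>
  A function space is given by a functional \<open>N\<close> defined on all Lebesgue measurable functions,
  with value \<open>\<infinity>\<close> outside the space; the values of \<open>N\<close> on non-measurable functions
  are irrelevant. Functions are complex valued and not quotiented by a.e. equality: all the notions
  below are invariant under changes on null sets.
\<close>

definition fspace :: "(('a::euclidean_space \<Rightarrow> complex) \<Rightarrow> ennreal) \<Rightarrow> ('a \<Rightarrow> complex) set" where
  "fspace N = {f \<in> borel_measurable lebesgue. N f < \<infinity>}"

locale ball_quasi_banach_space =
  fixes N :: "('a::euclidean_space \<Rightarrow> complex) \<Rightarrow> ennreal"
  assumes scale: "\<And>c f. f \<in> fspace N \<Longrightarrow> N (\<lambda>x. c * f x) = ennreal (norm c) * N f"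
    and quasi_triangle:
      "\<exists>K::real. \<forall>f \<in> fspace N. \<forall>g \<in> fspace N. N (\<lambda>x. f x + g x) \<le> ennreal K * (N f + N g)"
    and complete: "\<And>u :: nat \<Rightarrow> 'a \<Rightarrow> complex.
      \<lbrakk>\<And>m. u m \<in> fspace N;
       \<And>e::real. e > 0 \<Longrightarrow> \<exists>m0. \<forall>m\<ge>m0. \<forall>l\<ge>m0. N (\<lambda>x. u m x - u l x) < ennreal e\<rbrakk>
      \<Longrightarrow> \<exists>f \<in> fspace N. (\<lambda>m. N (\<lambda>x. u m x - f x)) \<longlonglongrightarrow> 0"
    and definite:
      "\<And>f. \<lbrakk>f \<in> borel_measurable lebesgue; N f = 0\<rbrakk> \<Longrightarrow> AE x in lebesgue. f x = 0"
    and lattice: "\<And>f g. \<lbrakk>f \<in> borel_measurable lebesgue; g \<in> borel_measurable lebesgue;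
      AE x in lebesgue. norm (g x) \<le> norm (f x)\<rbrakk> \<Longrightarrow> N g \<le> N f"
    and fatou: "\<And>(F :: nat \<Rightarrow> 'a \<Rightarrow> real) (f :: 'a \<Rightarrow> real).
      \<lbrakk>\<And>m. F m \<in> borel_measurable lebesgue; f \<in> borel_measurable lebesgue;
       AE x in lebesgue. (\<forall>m. 0 \<le> F m x) \<and> incseq (\<lambda>m. F m x) \<and> (\<lambda>m. F m x) \<longlonglongrightarrow> f x\<rbrakk>
      \<Longrightarrow> incseq (\<lambda>m. N (\<lambda>x. complex_of_real (F m x)))
        \<and> (\<lambda>m. N (\<lambda>x. complex_of_real (F m x))) \<longlonglongrightarrow> N (\<lambda>x. complex_of_real (f x))"
    and ball_mem: "\<And>z r. r > 0 \<Longrightarrow> indicator (ball z r) \<in> fspace N"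

locale ball_banach_space = ball_quasi_banach_space +
  assumes triangle:
      "\<And>f g. \<lbrakk>f \<in> fspace N; g \<in> fspace N\<rbrakk> \<Longrightarrow> N (\<lambda>x. f x + g x) \<le> N f + N g"
    and ball_integral: "\<And>z r. r > 0 \<Longrightarrow>
      \<exists>C::real. C > 0 \<and> (\<forall>f \<in> fspace N.
        (\<integral>\<^sup>+x\<in>ball z r. ennreal (norm (f x)) \<partial>lebesgue) \<le> ennreal C * N f)"

definition assoc ::
  "(('a::euclidean_space \<Rightarrow> complex) \<Rightarrow> ennreal) \<Rightarrow> ('a \<Rightarrow> complex) \<Rightarrow> ennreal" where
  "assoc N f = (SUP g \<in> {g \<in> borel_measurable lebesgue. N g \<le> 1}.
     \<integral>\<^sup>+x. ennreal (norm (f x * g x)) \<partial>lebesgue)"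

text \<open>
  Only the values of a functional on the space matter. Boundedness makes it respect a.e. equality.
\<close>

definition in_dual :: "(('a::euclidean_space \<Rightarrow> complex) \<Rightarrow> ennreal) \<Rightarrow>
    (('a \<Rightarrow> complex) \<Rightarrow> complex) \<Rightarrow> bool" where
  "in_dual N T \<longleftrightarrow>
     (\<forall>f \<in> fspace N. \<forall>g \<in> fspace N. T (\<lambda>x. f x + g x) = T f + T g) \<and>
     (\<forall>c. \<forall>f \<in> fspace N. T (\<lambda>x. c * f x) = c * T f) \<and>
     (\<exists>C::real. \<forall>f \<in> fspace N. ennreal (norm (T f)) \<le> ennreal C * N f)"

text \<open>
  The pairing induces a bijection (modulo a.e. equality) from the associate space onto the dual.
  It is then automatically isometric: multiply \<open>g\<close> by a unimodular function making
  \<open>f * g\<close> nonnegative.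
\<close>

definition assoc_eq_dual :: "(('a::euclidean_space \<Rightarrow> complex) \<Rightarrow> ennreal) \<Rightarrow> bool" where
  "assoc_eq_dual N \<longleftrightarrow>
     (\<forall>f \<in> fspace (assoc N). in_dual N (\<lambda>g. \<integral>x. f x * g x \<partial>lebesgue)) \<and>
     (\<forall>f1 \<in> fspace (assoc N). \<forall>f2 \<in> fspace (assoc N).
        (\<forall>g \<in> fspace N. (\<integral>x. f1 x * g x \<partial>lebesgue) = (\<integral>x. f2 x * g x \<partial>lebesgue)) \<longrightarrow>
        (AE x in lebesgue. f1 x = f2 x)) \<and>
     (\<forall>T. in_dual N T \<longrightarrow>
        (\<exists>f \<in> fspace (assoc N). \<forall>g \<in> fspace N. T g = (\<integral>x. f x * g x \<partial>lebesgue)))"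

definition is_delta :: "(('a::euclidean_space \<Rightarrow> complex) \<Rightarrow> ennreal) \<Rightarrow> real \<Rightarrow> bool" where
  "is_delta N \<delta> \<longleftrightarrow> 0 < \<delta> \<and> \<delta> < 1 \<and>
     (\<exists>C::real. C > 0 \<and> (\<forall>z r E. r > 0 \<longrightarrow> E \<in> sets lebesgue \<longrightarrow> E \<subseteq> ball z r \<longrightarrow>
        N (indicator E) / N (indicator (ball z r)) \<le>
        ennreal (C * (measure lebesgue E / measure lebesgue (ball z r)) powr \<delta>)))"

definition maximal :: "('a::euclidean_space \<Rightarrow> complex) \<Rightarrow> 'a \<Rightarrow> ennreal" where
  "maximal f x = (SUP (z, r) \<in> {(z, r). r > 0 \<and> x \<in> ball z r}.
     (\<integral>\<^sup>+y\<in>ball z r. ennreal (norm (f y)) \<partial>lebesgue) / emeasure lebesgue (ball z r))"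

text \<open>
  Boundedness on the space \<open>S\<close> with norm \<open>N\<close>. Since \<open>enn2real \<infinity> = 0\<close>, finiteness
  a.e. has to be required explicitly.
\<close>

definition maximal_bounded_on :: "('a::euclidean_space \<Rightarrow> complex) set \<Rightarrow>
    (('a \<Rightarrow> complex) \<Rightarrow> ennreal) \<Rightarrow> bool" where
  "maximal_bounded_on S N \<longleftrightarrow>
     (\<exists>C::real. C > 0 \<and> (\<forall>f \<in> S.
        (AE x in lebesgue. maximal f x < \<infinity>) \<and>
        (\<lambda>x. complex_of_real (enn2real (maximal f x))) \<in> S \<and>
        N (\<lambda>x. complex_of_real (enn2real (maximal f x))) \<le> ennreal C * N f))"

definition annulus :: "int \<Rightarrow> 'a::euclidean_space set" where
  "annulus k = ball 0 (2 powi k) - ball 0 (2 powi (k - 1))"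

definition restr :: "'a set \<Rightarrow> ('a \<Rightarrow> complex) \<Rightarrow> 'a \<Rightarrow> complex" where
  "restr A f = (\<lambda>x. f x * indicator A x)"

definition fspace_loc ::
  "(('a::euclidean_space \<Rightarrow> complex) \<Rightarrow> ennreal) \<Rightarrow> ('a \<Rightarrow> complex) set" where
  "fspace_loc N = {f \<in> borel_measurable lebesgue.
     \<forall>F. compact F \<longrightarrow> F \<subseteq> - {0} \<longrightarrow> restr F f \<in> fspace N}"

definition ennpowr :: "ennreal \<Rightarrow> real \<Rightarrow> ennreal" where
  "ennpowr x p = (if x = \<infinity> then \<infinity> else ennreal (enn2real x powr p))" \<comment> \<open>only for \<open>p > 0\<close>\<close>

definition herz_norm :: "real \<Rightarrow> real \<Rightarrow> (('a::euclidean_space \<Rightarrow> complex) \<Rightarrow> ennreal) \<Rightarrow>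
    ('a \<Rightarrow> complex) \<Rightarrow> ennreal" where
  "herz_norm \<alpha> p N f = ennpowr
     (\<Sum>\<^sub>\<infinity>k::int. ennreal (2 powr (of_int k * p * \<alpha>)) * ennpowr (N (restr (annulus k) f)) p) (1 / p)"

definition herz_space :: "real \<Rightarrow> real \<Rightarrow> (('a::euclidean_space \<Rightarrow> complex) \<Rightarrow> ennreal) \<Rightarrow>
    ('a \<Rightarrow> complex) set" where
  "herz_space \<alpha> p N = {f \<in> fspace_loc N. herz_norm \<alpha> p N f < \<infinity>}"

end

theory Submission
  imports Defs
begin

text \<open>
  Cut \<open>f\<close> into its pieces \<open>f\<^sub>l\<close> on the dyadic annuli. The maximal function is countably subadditive,
  so its norm on the annulus \<open>k\<close> is at most the sum over \<open>l\<close> of the norms there of the maximal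
  functions of the \<open>f\<^sub>l\<close>. For \<open>\<bar>k - l\<bar> \<le> 1\<close> the boundedness of the maximal operator on \<open>X\<close> is
  enough. For \<open>\<bar>k - l\<bar> \<ge> 2\<close> every ball that meets both annuli has a radius of at least
  \<open>2 powi max k l / 8\<close>, so on the annulus \<open>k\<close> the maximal function of \<open>f\<^sub>l\<close> is at most a constant
  times the mean of \<open>\<bar>f\<^sub>l\<bar>\<close> over the ball \<open>B\<close> of index \<open>max k l\<close>. Hoelder's inequality between
  \<open>X\<close> and its associate space \<open>X'\<close> turns this into norms of balls. Testing the maximal operator
  on the ball \<open>B\<close> shows that the product of its norms in \<open>X\<close> and \<open>X'\<close> is at most a constant
  times its volume (\<open>ball_norm_mult_assoc_le\<close>), and the exponents \<open>\<delta>X\<close> and \<open>\<delta>X'\<close> measure how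
  much smaller the norm of a smaller ball is. Since \<open>- n * \<delta>X < \<alpha> < n * \<delta>X'\<close>, the weights
  \<open>2 powr (k * \<alpha>)\<close> do not use up this gain, and the norm of the operator from the annulus \<open>l\<close> to
  the annulus \<open>k\<close> decays exponentially in \<open>\<bar>k - l\<bar>\<close> (\<open>annulus_estimate\<close>). Convolution with an
  exponentially decaying sequence is bounded on the \<open>p\<close>-summable sequences for every \<open>p > 0\<close>
  (\<open>exp_decay_convolution\<close>), which is the theorem.

  The maximal function may a priori be infinite on a large set. The argument is therefore carried out
  with an extension \<open>enorm\<close> of the norm to functions with values in \<open>[0, \<infinity>]\<close>, for which
  the Fatou property gives countable subadditivity, and a finite extended norm implies
  finiteness almost everywhere.
\<close>

section \<open>Powers and exponentially decaying convolutions over the integers\<close>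

lemma ennpowr_ennreal: "0 \<le> x \<Longrightarrow> ennpowr (ennreal x) p = ennreal (x powr p)"
  by (simp add: ennpowr_def)

lemma ennpowr_top [simp]: "ennpowr top p = top"
  by (simp add: ennpowr_def)

lemma ennpowr_less_top_iff: "ennpowr x p < top \<longleftrightarrow> x < top"
  by (cases x) (auto simp: ennpowr_ennreal)

lemma ennpowr_mono: "0 \<le> p \<Longrightarrow> x \<le> y \<Longrightarrow> ennpowr x p \<le> ennpowr y p"
  by (cases x; cases y) (auto simp: ennpowr_ennreal powr_mono2 top_unique)

lemma ennpowr_cmult: "0 < c \<Longrightarrow> ennpowr (ennreal c * x) p = ennreal (c powr p) * ennpowr x p"
  by (cases x) (auto simp: ennpowr_ennreal powr_mult ennreal_mult_top simp flip: ennreal_mult)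

lemma ennpowr_inverse: "0 < p \<Longrightarrow> ennpowr (ennpowr x p) (1 / p) = x"
  by (cases x) (auto simp: ennpowr_ennreal powr_powr)

lemma ennpowr_inverse': "0 < p \<Longrightarrow> ennpowr (ennpowr x (1 / p)) p = x"
  using ennpowr_inverse[of "1 / p" x] by simp

lemma nn_integral_int_eq_suminf:
  fixes f :: "int \<Rightarrow> ennreal"
  shows "(\<integral>\<^sup>+k. f k \<partial>count_space UNIV) = (\<Sum>n. f (int_decode n))"
  by (simp add: nn_integral_bij_count_space[OF bij_int_decode, symmetric] nn_integral_count_space_nat)

lemma infsum_int_eq_nn_integral:
  fixes f :: "int \<Rightarrow> ennreal"
  shows "infsum f UNIV = (\<integral>\<^sup>+k. f k \<partial>count_space UNIV)"
proof (rule antisym)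
  have "sum f F \<le> (\<integral>\<^sup>+k. f k \<partial>count_space UNIV)" if "finite F" for F
  proof -
    have "sum f F = (\<integral>\<^sup>+k. f k * indicator F k \<partial>count_space UNIV)"
      using that by (simp add: nn_integral_indicator_finite)
    also have "\<dots> \<le> (\<integral>\<^sup>+k. f k \<partial>count_space UNIV)"
      by (intro nn_integral_mono) (auto split: split_indicator)
    finally show ?thesis .
  qed
  then show "infsum f UNIV \<le> (\<integral>\<^sup>+k. f k \<partial>count_space UNIV)"
    by (auto simp: nonneg_infsum_complete intro: SUP_least)
  have "(\<Sum>i<n. f (int_decode i)) \<le> infsum f UNIV" for n
  proof -
    have "(\<Sum>i<n. f (int_decode i)) = sum f (int_decode ` {..<n})"
      by (subst sum.reindex) (auto intro: inj_on_subset[OF inj_int_decode])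
    also have "\<dots> \<le> infsum f UNIV"
      unfolding nonneg_infsum_complete[of UNIV f, simplified] by (rule SUP_upper) auto
    finally show ?thesis .
  qed
  then show "(\<integral>\<^sup>+k. f k \<partial>count_space UNIV) \<le> infsum f UNIV"
    unfolding nn_integral_int_eq_suminf by (intro suminf_le_const) auto
qed

lemma le_nn_integral_int:
  fixes f :: "int \<Rightarrow> ennreal"
  shows "f k \<le> (\<integral>\<^sup>+k. f k \<partial>count_space UNIV)"
proof -
  have "f k = (\<integral>\<^sup>+j. f j * indicator {k} j \<partial>count_space UNIV)"
    by simp
  also have "\<dots> \<le> (\<integral>\<^sup>+k. f k \<partial>count_space UNIV)"
    by (intro nn_integral_mono) (auto split: split_indicator)
  finally show ?thesis .
qed

text \<open>
  The enumeration of the integers visits \<open>j\<close> at a position at most \<open>2 * \<bar>j\<bar>\<close>,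
  hence the comparison with a geometric series of ratio \<open>2 powr (- \<epsilon> / 2)\<close>.
\<close>
lemma exp_decay_finite:
  assumes "0 < \<epsilon>"
  shows "(\<integral>\<^sup>+j. ennreal (2 powr (- \<epsilon> * real_of_int \<bar>j\<bar>)) \<partial>count_space UNIV) < top"
proof -
  define q :: real where "q = 2 powr (- \<epsilon>)"
  have q: "0 < q" "q < 1"
    using assms by (auto simp: q_def powr_less_one)
  have decay: "2 powr (- \<epsilon> * real_of_int \<bar>int_decode n\<bar>) \<le> sqrt q ^ n" for n
  proof -
    have "n \<le> 2 * nat \<bar>int_decode n\<bar>"
      by (auto simp: int_decode_def sum_decode_def elim!: evenE oddE)
    then have "sqrt q ^ (2 * nat \<bar>int_decode n\<bar>) \<le> sqrt q ^ n"
      using q by (intro power_decreasing) auto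
    moreover have "sqrt q ^ (2 * nat \<bar>int_decode n\<bar>) = q ^ nat \<bar>int_decode n\<bar>"
      using q by (simp add: power_mult)
    moreover have "q ^ nat \<bar>int_decode n\<bar> = 2 powr (- \<epsilon> * real_of_int \<bar>int_decode n\<bar>)"
      using q by (simp add: powr_realpow[symmetric] q_def powr_powr)
    ultimately show ?thesis by simp
  qed
  have sm: "summable (\<lambda>n. sqrt q ^ n)"
    using q by (intro summable_geometric) simp
  have "(\<Sum>n. ennreal (2 powr (- \<epsilon> * real_of_int \<bar>int_decode n\<bar>))) \<le> (\<Sum>n. ennreal (sqrt q ^ n))"
    by (rule suminf_le[OF ennreal_leI[OF decay] summableI summableI])
  also have "\<dots> < top"
  proof -
    have "(\<Sum>n. ennreal (sqrt q ^ n)) \<noteq> top"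
      by (rule ennreal_suminf_neq_top[OF sm]) (use q in simp)
    then show ?thesis
      by (rule top.not_eq_extremum[THEN iffD1])
  qed
  finally show ?thesis
    by (simp add: nn_integral_int_eq_suminf)
qed

text \<open>
  The sum over one index does not depend on the other, because a translation or a reflection
  permutes the integers.
\<close>
lemma exp_decay_sum:
  assumes "0 < \<epsilon>"
  obtains S where "0 < S"
    "\<And>k. (\<integral>\<^sup>+l. ennreal (2 powr (- \<epsilon> * real_of_int \<bar>k - l\<bar>)) \<partial>count_space UNIV) = ennreal S"
    "\<And>l. (\<integral>\<^sup>+k. ennreal (2 powr (- \<epsilon> * real_of_int \<bar>k - l\<bar>)) \<partial>count_space UNIV) = ennreal S"
proof -
  let ?f = "\<lambda>j. ennreal (2 powr (- \<epsilon> * real_of_int \<bar>j\<bar>))"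
  define S where "S = enn2real (\<integral>\<^sup>+j. ?f j \<partial>count_space UNIV)"
  have S: "(\<integral>\<^sup>+j. ?f j \<partial>count_space UNIV) = ennreal S"
    using exp_decay_finite[OF assms] by (simp add: S_def less_top)
  have "(1::ennreal) \<le> ennreal S"
    using le_nn_integral_int[of ?f 0] S by simp
  then have "0 < S"
    by (metis ennreal_neg linorder_not_le not_one_le_zero less_eq_real_def order.refl)
  moreover have "(\<integral>\<^sup>+l. ?f (k - l) \<partial>count_space UNIV) = ennreal S" for k
    using nn_integral_bij_count_space[OF bij_betwI[of "\<lambda>l. k - l" UNIV UNIV "\<lambda>l. k - l"], of ?f]
    unfolding S by fastforce
  moreover have "(\<integral>\<^sup>+k. ?f (k - l) \<partial>count_space UNIV) = ennreal S" for l
    using nn_integral_bij_count_space[OF bij_betwI[of "\<lambda>k. k - l" UNIV UNIV "\<lambda>k. k + l"], of ?f]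
    unfolding S by fastforce
  ultimately show ?thesis using that by blast
qed

text \<open>
  Convolution with an exponentially decaying kernel is bounded on the \<open>p\<close>-summable sequences for
  every \<open>p > 0\<close>. Minkowski's inequality is not available for \<open>p < 1\<close>; instead the kernel is
  written as \<open>h\<^sup>2\<close>. One factor \<open>h\<close> makes the sum over \<open>l\<close> finite once the other
  factor times \<open>c l\<close> is estimated by its supremum over \<open>l\<close>, and the \<open>p\<close>-th power of a
  supremum is at most the sum of the \<open>p\<close>-th powers. This treats all \<open>p\<close> alike.
\<close>
lemma exp_decay_convolution:
  fixes p \<epsilon> D :: real
  assumes "0 < p" "0 < \<epsilon>" "0 < D"
  obtains C where "0 < C"
    "\<And>a c. \<forall>k. a k \<le> (\<integral>\<^sup>+l. ennreal (D * 2 powr (- \<epsilon> * real_of_int \<bar>k - l\<bar>)) * c l \<partial>count_space UNIV) \<Longrightarrow>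
      (\<integral>\<^sup>+k. ennpowr (a k) p \<partial>count_space (UNIV::int set))
        \<le> ennreal C * (\<integral>\<^sup>+l. ennpowr (c l) p \<partial>count_space UNIV)"
proof -
  define h where "h k l = (2::real) powr (- (\<epsilon> / 2) * real_of_int \<bar>k - l\<bar>)" for k l :: int
  have hpos: "0 < h k l" for k l by (simp add: h_def)
  have hh: "2 powr (- \<epsilon> * real_of_int \<bar>k - l\<bar>) = h k l * h k l" for k l
    by (simp add: h_def powr_add[symmetric])
  have hp: "h k l powr p = 2 powr (- (\<epsilon> / 2 * p) * real_of_int \<bar>k - l\<bar>)" for k l
    by (simp add: h_def powr_powr mult_ac)
  obtain S where S: "0 < S" "\<And>k. (\<integral>\<^sup>+l. ennreal (h k l) \<partial>count_space UNIV) = ennreal S"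
    using exp_decay_sum[of "\<epsilon> / 2"] assms unfolding h_def by (metis half_gt_zero)
  obtain T where T: "0 < T" "\<And>l. (\<integral>\<^sup>+k. ennreal (h k l powr p) \<partial>count_space UNIV) = ennreal T"
    using exp_decay_sum[of "\<epsilon> / 2 * p"] assms unfolding hp by (metis half_gt_zero mult_pos_pos)
  let ?C = "(D * S) powr p * T"
  show thesis
  proof (rule that[of ?C])
    show "0 < ?C" using assms S T by simp
    fix a c :: "int \<Rightarrow> ennreal"
    assume a: "\<forall>k. a k \<le> (\<integral>\<^sup>+l. ennreal (D * 2 powr (- \<epsilon> * real_of_int \<bar>k - l\<bar>)) * c l \<partial>count_space UNIV)"
    define R where "R k = (\<integral>\<^sup>+l. ennpowr (ennreal (h k l) * c l) p \<partial>count_space UNIV)" for k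
    \<comment> \<open>The bound of a supremum by a sum: no term exceeds the \<open>p\<close>-th root of the sum of all \<open>p\<close>-th powers.\<close>
    have R: "ennreal (h k l) * c l \<le> ennpowr (R k) (1 / p)" for k l
    proof -
      have "ennpowr (ennreal (h k l) * c l) p \<le> R k"
        unfolding R_def by (rule le_nn_integral_int)
      then have "ennpowr (ennpowr (ennreal (h k l) * c l) p) (1 / p) \<le> ennpowr (R k) (1 / p)"
        using assms by (intro ennpowr_mono) auto
      then show ?thesis using assms by (simp add: ennpowr_inverse)
    qed
    have "ennpowr (a k) p \<le> ennreal ((D * S) powr p) * R k" for k
    proof -
      have "a k \<le> (\<integral>\<^sup>+l. ennreal D * (ennreal (h k l) * (ennreal (h k l) * c l)) \<partial>count_space UNIV)"
        using spec[OF a, of k] \<open>0 < D\<close> hpos unfolding hh by (simp add: ennreal_mult less_imp_le mult_ac)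
      also have "\<dots> \<le> (\<integral>\<^sup>+l. ennreal D * (ennreal (h k l) * ennpowr (R k) (1 / p)) \<partial>count_space UNIV)"
        by (intro nn_integral_mono mult_left_mono R) auto
      also have "\<dots> = (\<integral>\<^sup>+l. (ennreal D * ennpowr (R k) (1 / p)) * ennreal (h k l) \<partial>count_space UNIV)"
        by (simp only: mult_ac)
      also have "\<dots> = ennreal D * ennpowr (R k) (1 / p) * ennreal S"
        by (simp add: nn_integral_cmult S)
      also have "\<dots> = ennreal (D * S) * ennpowr (R k) (1 / p)"
        using assms S by (simp add: ennreal_mult mult_ac)
      finally have "ennpowr (a k) p \<le> ennpowr (ennreal (D * S) * ennpowr (R k) (1 / p)) p"
        using assms by (intro ennpowr_mono) auto
      then show ?thesis
        using assms S by (simp add: ennpowr_cmult ennpowr_inverse')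
    qed
    then have "(\<integral>\<^sup>+k. ennpowr (a k) p \<partial>count_space UNIV)
        \<le> (\<integral>\<^sup>+k. ennreal ((D * S) powr p) * R k \<partial>count_space UNIV)"
      by (intro nn_integral_mono) auto
    also have "\<dots> = ennreal ((D * S) powr p) * (\<integral>\<^sup>+k. R k \<partial>count_space UNIV)"
      by (simp add: nn_integral_cmult)
    also have "(\<integral>\<^sup>+k. R k \<partial>count_space UNIV) =
        (\<integral>\<^sup>+l. (\<integral>\<^sup>+k. ennpowr (c l) p * ennreal (h k l powr p) \<partial>count_space UNIV) \<partial>count_space UNIV)"
      unfolding R_def using hpos
      by (subst nn_integral_count_space_nn_integral) (auto simp: ennpowr_cmult mult.commute[of "ennpowr _ _"])
    also have "\<dots> = ennreal T * (\<integral>\<^sup>+l. ennpowr (c l) p \<partial>count_space UNIV)"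
      by (simp add: nn_integral_cmult nn_integral_multc T mult.commute)
    finally show "(\<integral>\<^sup>+k. ennpowr (a k) p \<partial>count_space UNIV)
        \<le> ennreal ?C * (\<integral>\<^sup>+l. ennpowr (c l) p \<partial>count_space UNIV)"
      using T by (simp add: ennreal_mult mult_ac)
  qed
qed

section \<open>The norm of a nonnegative extended-valued function\<close>

text \<open>
  A functional on complex valued functions says nothing about a function such as a maximal function,
  which may be infinite somewhere, and replacing \<open>\<infinity>\<close> by \<open>0\<close> would destroy monotonicity.
  Passing to bounded truncations first gives a norm on all measurable functions with values in
  \<open>[0, \<infinity>]\<close>, which is monotone and countably subadditive, and whose finiteness implies finiteness
  almost everywhere.
\<close>
definition trunc :: "nat \<Rightarrow> ('a \<Rightarrow> ennreal) \<Rightarrow> 'a \<Rightarrow> complex" where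
  "trunc m u = (\<lambda>x. complex_of_real (enn2real (min (u x) (of_nat m))))"

definition enorm :: "(('a \<Rightarrow> complex) \<Rightarrow> ennreal) \<Rightarrow> ('a \<Rightarrow> ennreal) \<Rightarrow> ennreal" where
  "enorm N u = (SUP m. N (trunc m u))"

lemma min_of_nat_less_top [simp]: "min x (of_nat m) < (top::ennreal)"
  by (simp add: min_less_iff_disj of_nat_less_top)

lemma norm_trunc: "norm (trunc m u x) = enn2real (min (u x) (of_nat m))"
  by (simp add: trunc_def)

lemma ennreal_norm_trunc: "ennreal (norm (trunc m u x)) = min (u x) (of_nat m)"
  by (simp add: norm_trunc)

lemma measurable_trunc [measurable]:
  "u \<in> borel_measurable M \<Longrightarrow> trunc m u \<in> borel_measurable M"
  unfolding trunc_def by measurable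

lemma trunc_le_enorm: "N (trunc m u) \<le> enorm N u"
  unfolding enorm_def by (rule SUP_upper) simp

lemma min_add_le: "min (a + b) c \<le> min a c + min b (c::ennreal)"
proof (cases "a \<le> c \<and> b \<le> c")
  case True
  then show ?thesis by (simp add: min_absorb1)
next
  case False
  then have "c \<le> min a c + min b c"
    by (metis add_increasing add_increasing2 linear min.absorb2 order_refl zero_le)
  then show ?thesis by (rule min.coboundedI2)
qed

context ball_banach_space
begin

lemma lattice_ennreal:
  assumes "f \<in> borel_measurable lebesgue" "g \<in> borel_measurable lebesgue"
    "AE x in lebesgue. ennreal (norm (g x)) \<le> ennreal (norm (f x))"
  shows "N g \<le> N f"
  using assms by (intro lattice) (auto simp: ennreal_le_iff)

lemma zero_norm: "N (\<lambda>x. 0) = 0"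
  using scale[OF ball_mem[of 1 0], of 0] by simp

text \<open>
  Outside the space the right-hand side is infinite.
\<close>
lemma triangle_measurable:
  assumes "f \<in> borel_measurable lebesgue" "g \<in> borel_measurable lebesgue"
  shows "N (\<lambda>x. f x + g x) \<le> N f + N g"
proof (cases "N f < top \<and> N g < top")
  case True
  then show ?thesis using assms by (intro triangle) (auto simp: fspace_def)
next
  case False
  then have "N f + N g = top" by (auto simp flip: less_top)
  then show ?thesis by (metis top_greatest)
qed

lemma enorm_mono:
  assumes [measurable]: "u \<in> borel_measurable lebesgue" "v \<in> borel_measurable lebesgue"
    and le: "AE x in lebesgue. u x \<le> v x"
  shows "enorm N u \<le> enorm N v"
  unfolding enorm_def
proof (intro SUP_mono)
  fix m
  show "\<exists>m'\<in>UNIV. N (trunc m u) \<le> N (trunc m' v)"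
  proof (intro bexI[of _ m] lattice_ennreal)
    show "AE x in lebesgue. ennreal (norm (trunc m u x)) \<le> ennreal (norm (trunc m v x))"
      using le unfolding ennreal_norm_trunc by eventually_elim (rule min.mono, auto)
  qed auto
qed

lemma enorm_le:
  assumes [measurable]: "u \<in> borel_measurable lebesgue" "f \<in> borel_measurable lebesgue"
    and le: "AE x in lebesgue. u x \<le> ennreal (norm (f x))"
  shows "enorm N u \<le> N f"
  unfolding enorm_def
proof (intro SUP_least)
  fix m
  show "N (trunc m u) \<le> N f"
    using le by (intro lattice_ennreal) (auto simp: ennreal_norm_trunc intro: min.coboundedI1)
qed

text \<open>
  The truncations of the function with \<open>\<infinity>\<close> replaced by \<open>0\<close> increase to it, so the Fatou
  property applies; at each level they lie below the truncations of \<open>u\<close> itself.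
\<close>
lemma norm_enn2real_le_enorm:
  assumes [measurable]: "u \<in> borel_measurable lebesgue"
  shows "N (\<lambda>x. complex_of_real (enn2real (u x))) \<le> enorm N u"
proof -
  let ?F = "\<lambda>m x. min (enn2real (u x)) (real m)"
  have lim: "(\<lambda>m. ?F m x) \<longlonglongrightarrow> enn2real (u x)" for x
  proof (rule tendsto_eventually)
    show "\<forall>\<^sub>F m in sequentially. ?F m x = enn2real (u x)"
      using eventually_ge_at_top[of "nat \<lceil>enn2real (u x)\<rceil>"]
      by eventually_elim (auto simp: min_def nat_le_iff ceiling_le_iff)
  qed
  have conv: "(\<lambda>m. N (\<lambda>x. complex_of_real (?F m x))) \<longlonglongrightarrow> N (\<lambda>x. complex_of_real (enn2real (u x)))"
    using lim by (intro conjunct2[OF fatou]) (auto simp: incseq_def min_def)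
  have bound: "N (\<lambda>x. complex_of_real (?F m x)) \<le> enorm N u" for m
  proof -
    have "N (\<lambda>x. complex_of_real (?F m x)) \<le> N (trunc m u)"
    proof (intro lattice AE_I2)
      fix x
      show "norm (complex_of_real (?F m x)) \<le> norm (trunc m u x)"
        by (cases "u x") (auto simp: norm_trunc min_def top_unique simp flip: ennreal_of_nat_eq_real_of_nat)
    qed auto
    also have "\<dots> \<le> enorm N u" by (rule trunc_le_enorm)
    finally show ?thesis .
  qed
  show ?thesis
    by (rule LIMSEQ_le_const2[OF conv]) (use bound in blast)
qed

lemma enorm_add:
  assumes [measurable]: "u \<in> borel_measurable lebesgue" "v \<in> borel_measurable lebesgue"
  shows "enorm N (\<lambda>x. u x + v x) \<le> enorm N u + enorm N v"
  unfolding enorm_def[of N "\<lambda>x. u x + v x"]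
proof (intro SUP_least)
  fix m
  have "N (trunc m (\<lambda>x. u x + v x)) \<le> N (\<lambda>x. trunc m u x + trunc m v x)"
  proof (intro lattice_ennreal AE_I2)
    fix x
    have "min (u x + v x) (of_nat m) \<le> min (u x) (of_nat m) + min (v x) (of_nat m)"
      by (rule min_add_le)
    also have "\<dots> = ennreal (norm (trunc m u x + trunc m v x))"
      by (simp add: trunc_def ennreal_plus flip: of_real_add)
    finally show "ennreal (norm (trunc m (\<lambda>x. u x + v x) x)) \<le> ennreal (norm (trunc m u x + trunc m v x))"
      by (simp add: ennreal_norm_trunc)
  qed measurable
  also have "\<dots> \<le> N (trunc m u) + N (trunc m v)"
    by (intro triangle_measurable) measurable
  also have "\<dots> \<le> enorm N u + enorm N v"
    by (intro add_mono trunc_le_enorm)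
  finally show "N (trunc m (\<lambda>x. u x + v x)) \<le> enorm N u + enorm N v" .
qed

lemma enorm_sum:
  assumes [measurable]: "\<And>i. u i \<in> borel_measurable lebesgue"
  shows "enorm N (\<lambda>x. \<Sum>i<n::nat. u i x) \<le> (\<Sum>i<n. enorm N (u i))"
proof (induction n)
  case 0
  show ?case by (simp add: enorm_def trunc_def zero_norm)
next
  case (Suc n)
  have "enorm N (\<lambda>x. (\<Sum>i<n. u i x) + u n x) \<le> enorm N (\<lambda>x. \<Sum>i<n. u i x) + enorm N (u n)"
    by (intro enorm_add) measurable
  also have "\<dots> \<le> (\<Sum>i<n. enorm N (u i)) + enorm N (u n)"
    by (intro add_mono Suc order_refl)
  finally show ?case by simp
qed

text \<open>
  At a fixed truncation level the partial sums increase to the full sum, so the Fatou property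
  passes the finite triangle inequality to the limit.
\<close>
lemma enorm_suminf:
  assumes [measurable]: "\<And>i. u i \<in> borel_measurable lebesgue"
  shows "enorm N (\<lambda>x. \<Sum>i. u i x) \<le> (\<Sum>i. enorm N (u i))"
  unfolding enorm_def[of N "\<lambda>x. \<Sum>i. u i x"]
proof (intro SUP_least)
  fix m
  let ?t = "\<lambda>n x. enn2real (min (\<Sum>i<n. u i x) (of_nat m))"
  have conv: "(\<lambda>n. N (\<lambda>x. complex_of_real (?t n x))) \<longlonglongrightarrow>
      N (\<lambda>x. complex_of_real (enn2real (min (\<Sum>i. u i x) (of_nat m))))"
  proof (intro conjunct2[OF fatou] AE_I2 conjI)
    fix x
    show "incseq (\<lambda>n. ?t n x)"
      by (auto simp: incseq_def intro!: enn2real_mono min.mono sum_mono2)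
    show "(\<lambda>n. ?t n x) \<longlonglongrightarrow> enn2real (min (\<Sum>i. u i x) (of_nat m))"
    proof -
      have "(\<lambda>n. min (\<Sum>i<n. u i x) (of_nat m)) \<longlonglongrightarrow> min (\<Sum>i. u i x) (of_nat m)"
        by (intro tendsto_min summable_LIMSEQ tendsto_const summableI)
      then show ?thesis by (intro tendsto_enn2real) auto
    qed
  qed auto
  have bound: "N (\<lambda>x. complex_of_real (?t n x)) \<le> (\<Sum>i. enorm N (u i))" for n
  proof -
    have "N (\<lambda>x. complex_of_real (?t n x)) = N (trunc m (\<lambda>x. \<Sum>i<n. u i x))"
      by (simp add: trunc_def)
    also have "\<dots> \<le> (\<Sum>i<n. enorm N (u i))"
      by (intro order_trans[OF trunc_le_enorm enorm_sum]) measurable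
    also have "\<dots> \<le> (\<Sum>i. enorm N (u i))"
      by (intro sum_le_suminf) auto
    finally show ?thesis .
  qed
  show "N (trunc m (\<lambda>x. \<Sum>i. u i x)) \<le> (\<Sum>i. enorm N (u i))"
    unfolding trunc_def by (rule LIMSEQ_le_const2[OF conv]) (use bound in blast)
qed

lemma enorm_nn_integral_int:
  fixes u :: "int \<Rightarrow> 'a \<Rightarrow> ennreal"
  assumes "\<And>l. u l \<in> borel_measurable lebesgue"
  shows "enorm N (\<lambda>x. \<integral>\<^sup>+l. u l x \<partial>count_space UNIV) \<le> (\<integral>\<^sup>+l. enorm N (u l) \<partial>count_space UNIV)"
  unfolding nn_integral_int_eq_suminf using assms by (intro enorm_suminf) auto

text \<open>
  On the set where \<open>u\<close> is infinite the \<open>j\<close>-th truncation equals \<open>j\<close>. The norm of its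
  indicator is therefore at most \<open>enorm N u / j\<close> for every \<open>j\<close>, so it is zero.
\<close>
lemma enorm_finite_imp_AE_finite:
  assumes [measurable]: "u \<in> borel_measurable lebesgue" and fin: "enorm N u < top"
  shows "AE x in lebesgue. u x < top"
proof -
  define E where "E = {x. u x = top}"
  have [measurable]: "E \<in> sets lebesgue"
    unfolding E_def using measurable_sets[OF assms(1), of "{top}"] by (simp add: vimage_def)
  let ?e = "indicator E :: 'a \<Rightarrow> complex"
  have bound: "N (\<lambda>x. of_nat j * ?e x) \<le> enorm N u" for j
  proof -
    have "N (\<lambda>x. of_nat j * ?e x) \<le> N (trunc j u)"
      by (intro lattice_ennreal AE_I2)
        (auto simp: ennreal_norm_trunc E_def indicator_def norm_mult ennreal_of_nat_eq_real_of_nat)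
    also have "\<dots> \<le> enorm N u" by (rule trunc_le_enorm)
    finally show ?thesis .
  qed
  from bound[of 1] fin have e: "?e \<in> fspace N"
    by (auto simp: fspace_def)
  have "of_nat j * N ?e \<le> enorm N u" for j
    using bound[of j] scale[OF e, of "of_nat j"] by (simp add: ennreal_of_nat_eq_real_of_nat)
  then have "N ?e = 0"
  proof -
    have "(SUP j. of_nat j :: ennreal) * N ?e \<le> enorm N u"
      using \<open>\<And>j. of_nat j * N ?e \<le> enorm N u\<close> by (simp add: SUP_mult_right_ennreal SUP_least)
    then show ?thesis
      using fin by (auto simp: ennreal_SUP_of_nat_eq_top ennreal_top_mult split: if_splits)
  qed
  then have "AE x in lebesgue. ?e x = 0"
    by (intro definite) auto
  then show ?thesis
    by eventually_elim (auto simp: E_def less_top indicator_def split: if_splits)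
qed

end

section \<open>The maximal function and dyadic annuli\<close>

lemma ball_sets_lebesgue [measurable]: "ball (z::'a::euclidean_space) r \<in> sets lebesgue"
  by simp

text \<open>
  The maximal function is lower semicontinuous, because the average over an open ball bounds it
  from below at all points of that ball.
\<close>
lemma borel_measurable_maximal: "maximal f \<in> borel_measurable borel"
proof (rule borel_measurableI_greater)
  fix t
  let ?A = "\<lambda>z r. (\<integral>\<^sup>+y\<in>ball z r. ennreal (norm (f y)) \<partial>lebesgue) / emeasure lebesgue (ball z r)"
  have "{x. t < maximal f x} = (\<Union>(z, r)\<in>{(z, r). 0 < r \<and> t < ?A z r}. ball z r)"
    by (auto simp: maximal_def less_SUP_iff) blast+
  moreover have "open (\<Union>(z, r)\<in>{(z, r). 0 < r \<and> t < ?A z r}. ball z r)"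
    by (intro open_UN) auto
  ultimately show "{x \<in> space borel. t < maximal f x} \<in> sets borel"
    by simp
qed

lemma borel_measurable_maximal_lebesgue [measurable]: "maximal f \<in> borel_measurable lebesgue"
  by (rule measurable_completion) (simp add: borel_measurable_maximal)

lemma maximal_le_nn_integral_int:
  fixes g :: "int \<Rightarrow> 'a::euclidean_space \<Rightarrow> complex"
  assumes [measurable]: "\<And>l. g l \<in> borel_measurable lebesgue"
    and le: "AE y in lebesgue. ennreal (norm (f y)) \<le> (\<integral>\<^sup>+l. ennreal (norm (g l y)) \<partial>count_space UNIV)"
  shows "maximal f x \<le> (\<integral>\<^sup>+l. maximal (g l) x \<partial>count_space UNIV)"
  unfolding maximal_def[of f]
proof (rule SUP_least, clarify)
  fix z :: 'a and r :: real
  assume r: "0 < r" "x \<in> ball z r"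
  let ?c = "inverse (emeasure lebesgue (ball z r))"
  have "(\<integral>\<^sup>+y\<in>ball z r. ennreal (norm (f y)) \<partial>lebesgue)
      \<le> (\<integral>\<^sup>+y. (\<integral>\<^sup>+l. ennreal (norm (g l y)) * indicator (ball z r) y \<partial>count_space UNIV) \<partial>lebesgue)"
  proof (rule nn_integral_mono_AE)
    show "AE y in lebesgue. ennreal (norm (f y)) * indicator (ball z r) y
        \<le> (\<integral>\<^sup>+l. ennreal (norm (g l y)) * indicator (ball z r) y \<partial>count_space UNIV)"
      using le by eventually_elim (simp add: nn_integral_multc mult_right_mono)
  qed
  also have "\<dots> = (\<integral>\<^sup>+l. (\<integral>\<^sup>+y\<in>ball z r. ennreal (norm (g l y)) \<partial>lebesgue) \<partial>count_space UNIV)"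
    by (rule nn_integral_count_space_nn_integral) auto
  finally have "(\<integral>\<^sup>+y\<in>ball z r. ennreal (norm (f y)) \<partial>lebesgue) / emeasure lebesgue (ball z r)
      \<le> (\<integral>\<^sup>+l. (\<integral>\<^sup>+y\<in>ball z r. ennreal (norm (g l y)) \<partial>lebesgue) \<partial>count_space UNIV) * ?c"
    unfolding divide_ennreal_def by (rule mult_right_mono) simp
  also have "\<dots> = (\<integral>\<^sup>+l. (\<integral>\<^sup>+y\<in>ball z r. ennreal (norm (g l y)) \<partial>lebesgue) * ?c \<partial>count_space UNIV)"
    by (rule nn_integral_multc[symmetric]) simp
  also have "\<dots> \<le> (\<integral>\<^sup>+l. maximal (g l) x \<partial>count_space UNIV)"
    unfolding maximal_def divide_ennreal_def[symmetric]
    using r by (intro nn_integral_mono SUP_upper2[of "(z, r)"]) auto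
  finally show "(\<integral>\<^sup>+y\<in>ball z r. ennreal (norm (f y)) \<partial>lebesgue) / emeasure lebesgue (ball z r)
      \<le> (\<integral>\<^sup>+l. maximal (g l) x \<partial>count_space UNIV)" .
qed

lemma mem_annulus_iff: "x \<in> annulus k \<longleftrightarrow> 2 powi (k - 1) \<le> norm x \<and> norm x < 2 powi k"
  by (auto simp: annulus_def)

lemma annulus_exhausts:
  assumes "x \<noteq> 0"
  obtains k where "x \<in> annulus k"
proof
  let ?m = "\<lfloor>log 2 (norm x)\<rfloor>"
  have "2 powr ?m \<le> 2 powr log 2 (norm x)" "2 powr log 2 (norm x) < 2 powr (?m + 1)"
    by (simp_all only: powr_less_cancel_iff powr_le_cancel_iff) linarith+
  then have "2 powr ?m \<le> norm x" "norm x < 2 powr (?m + 1)"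
    using assms by auto
  then show "x \<in> annulus (?m + 1)"
    using powr_real_of_int'[of 2 ?m] powr_real_of_int'[of 2 "?m + 1"]
    by (simp add: mem_annulus_iff)
qed

lemma annulus_subset_ball: "annulus k \<subseteq> ball 0 (2 powi k)"
  by (auto simp: annulus_def)

lemma annulus_sets [measurable]: "annulus k \<in> sets lebesgue"
  by (auto simp: annulus_def)

lemma measurable_restr [measurable]:
  assumes [measurable]: "f \<in> borel_measurable lebesgue" "A \<in> sets lebesgue"
  shows "restr A f \<in> borel_measurable lebesgue"
  unfolding restr_def by measurable

lemma norm_le_sum_restr_annulus:
  assumes "y \<noteq> 0"
  shows "ennreal (norm (f y)) \<le> (\<integral>\<^sup>+l. ennreal (norm (restr (annulus l) f y)) \<partial>count_space UNIV)"
proof -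
  obtain k where "y \<in> annulus k" using annulus_exhausts[OF assms] .
  then have "ennreal (norm (f y)) = ennreal (norm (restr (annulus k) f y))"
    by (simp add: restr_def)
  also have "\<dots> \<le> (\<integral>\<^sup>+l. ennreal (norm (restr (annulus l) f y)) \<partial>count_space UNIV)"
    by (rule le_nn_integral_int)
  finally show ?thesis .
qed

lemma AE_lebesgue_neq_0: "AE x::'a::euclidean_space in lebesgue. x \<noteq> 0"
  by (intro AE_completion AE_lborel_singleton)

lemma maximal_le_sum_annuli:
  assumes [measurable]: "f \<in> borel_measurable lebesgue"
  shows "maximal f x \<le> (\<integral>\<^sup>+l. maximal (restr (annulus l) f) x \<partial>count_space UNIV)"
proof (rule maximal_le_nn_integral_int)
  show "AE y in lebesgue. ennreal (norm (f y))
      \<le> (\<integral>\<^sup>+l. ennreal (norm (restr (annulus l) f y)) \<partial>count_space UNIV)"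
    using AE_lebesgue_neq_0 by eventually_elim (rule norm_le_sum_restr_annulus)
qed measurable

text \<open>
  The point of the inner annulus has norm less than half of the lower bound for the norm of the other
  point, so the two points are at distance at least a quarter of \<open>2 powi k\<close>, and they lie in a ball
  of radius \<open>r\<close>.
\<close>
lemma separated_annuli_radius:
  fixes x y z :: "'a::euclidean_space"
  assumes "x \<in> annulus k" "y \<in> annulus l" "l + 2 \<le> k" "x \<in> ball z r" "y \<in> ball z r"
  shows "2 powi k \<le> 8 * r"
proof -
  have "norm y < 2 powi l" using assms by (simp add: mem_annulus_iff)
  also have "(2::real) powi l \<le> 2 powi (k - 2)" using assms by (intro power_int_increasing) auto
  finally have "norm y < 2 powi k / 4" by (simp add: power_int_diff)
  moreover have "2 powi k / 2 \<le> norm x" using assms by (simp add: mem_annulus_iff power_int_diff)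
  moreover have "norm x \<le> norm y + dist x y"
    by (metis dist_norm norm_triangle_sub)
  moreover have "dist x y < 2 * r"
    using assms dist_triangle_less_add[of x z r y r] by (simp add: dist_commute)
  ultimately show ?thesis by linarith
qed

lemma ennreal_divide_le_of_le_mult:
  fixes a b c :: real
  assumes "0 < a" "0 < b" "0 \<le> c" "a \<le> c * b"
  shows "I / ennreal b \<le> ennreal c * I / ennreal a"
proof (cases I)
  case (real t)
  have "t * a \<le> t * (c * b)"
    using assms real by (intro mult_left_mono) auto
  then have "t / b \<le> c * t / a"
    using assms by (simp add: field_simps)
  then show ?thesis
    using assms real by (simp add: divide_ennreal flip: ennreal_mult)
next
  case top
  have "0 < c" using assms by (metis less_le_trans mult_zero_left order_le_less less_irrefl)
  then show ?thesis
    using assms top by (simp add: ennreal_mult_top ennreal_top_divide)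
qed

lemma divide_emeasure_ball_le_8:
  fixes z w :: "'a::euclidean_space"
  assumes "0 < R" "R \<le> 8 * r"
  shows "I / emeasure lebesgue (ball z r) \<le> ennreal (8 ^ DIM('a)) * I / emeasure lebesgue (ball w R)"
proof -
  have "R ^ DIM('a) \<le> 8 ^ DIM('a) * r ^ DIM('a)"
    using power_mono[of R "8 * r" "DIM('a)"] assms by (simp add: power_mult_distrib)
  then have "unit_ball_vol DIM('a) * R ^ DIM('a) \<le> 8 ^ DIM('a) * (unit_ball_vol DIM('a) * r ^ DIM('a))"
    by (simp add: mult.left_commute mult_left_mono)
  with assms have "I / ennreal (unit_ball_vol DIM('a) * r ^ DIM('a)) \<le>
      ennreal (8 ^ DIM('a)) * I / ennreal (unit_ball_vol DIM('a) * R ^ DIM('a))"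
    by (intro ennreal_divide_le_of_le_mult) auto
  then show ?thesis
    using assms by (simp add: emeasure_ball)
qed

text \<open>
  A ball that meets both annuli has a radius of at least an eighth of that of the larger annulus. The
  other balls average to zero, and the averages over these are bounded by the mean over the
  ball of index \<open>max k l\<close>, up to the dimensional factor.
\<close>
lemma maximal_separated_annuli:
  fixes f :: "'a::euclidean_space \<Rightarrow> complex"
  assumes x: "x \<in> annulus k" and kl: "2 \<le> \<bar>k - l\<bar>"
  shows "maximal (restr (annulus l) f) x \<le>
    ennreal (8 ^ DIM('a)) * (\<integral>\<^sup>+y. ennreal (norm (restr (annulus l) f y)) \<partial>lebesgue)
      / emeasure lebesgue (ball (0::'a) (2 powi max k l))"
  unfolding maximal_def
proof (rule SUP_least, clarify)
  fix z :: 'a and r :: real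
  assume r: "0 < r" "x \<in> ball z r"
  let ?g = "restr (annulus l) f" and ?B = "ball (0::'a) (2 powi max k l)"
  let ?I = "\<integral>\<^sup>+y. ennreal (norm (?g y)) \<partial>lebesgue" and ?J = "\<integral>\<^sup>+y\<in>ball z r. ennreal (norm (?g y)) \<partial>lebesgue"
  show "?J / emeasure lebesgue (ball z r) \<le> ennreal (8 ^ DIM('a)) * ?I / emeasure lebesgue ?B"
  proof (cases "ball z r \<inter> annulus l = {}")
    case True
    then have "?J = (\<integral>\<^sup>+y. 0 \<partial>(lebesgue :: 'a measure))"
      by (intro nn_integral_cong) (auto simp: restr_def indicator_def)
    then show ?thesis by simp
  next
    case False
    then obtain y where y: "y \<in> ball z r" "y \<in> annulus l" by auto
    have "2 powi max k l \<le> 8 * r"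
    proof (cases "l + 2 \<le> k")
      case True
      then show ?thesis using separated_annuli_radius[OF x y(2) _ r(2) y(1)] by simp
    next
      case False
      then show ?thesis using separated_annuli_radius[OF y(2) x _ y(1) r(2)] kl by simp
    qed
    have "?J \<le> ?I"
      by (intro nn_integral_mono) (auto split: split_indicator)
    then have "?J / emeasure lebesgue (ball z r) \<le> ?I / emeasure lebesgue (ball z r)"
      by (rule divide_right_mono_ennreal)
    also have "\<dots> \<le> ennreal (8 ^ DIM('a)) * ?I / emeasure lebesgue ?B"
      using \<open>2 powi max k l \<le> 8 * r\<close> by (intro divide_emeasure_ball_le_8) auto
    finally show ?thesis .
  qed
qed

section \<open>Norms of balls in a space and in its associate space\<close>

text \<open>
  This holds for the degenerate divisors as well: \<open>x / 0\<close> is infinite unless \<open>x = 0\<close>, and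
  \<open>c * \<infinity>\<close> is infinite.
\<close>
lemma ennreal_le_mult_of_divide_le:
  fixes x y :: ennreal
  assumes "x / y \<le> ennreal c" "0 < c"
  shows "x \<le> ennreal c * y"
proof (cases "y = 0 \<or> y = top")
  case True
  then show ?thesis
    using assms by (auto simp: ennreal_mult_top top_unique split: if_splits)
next
  case False
  then have "x = x / y * y"
    by (simp add: ennreal_divide_times less_top)
  also have "\<dots> \<le> ennreal c * y"
    using assms(1) by (rule mult_right_mono) simp
  finally show ?thesis .
qed

lemma measure_dyadic_ball_ratio:
  "measure lebesgue (ball (0::'a::euclidean_space) (2 powi k)) / measure lebesgue (ball (0::'a) (2 powi m))
    = 2 powr (- (real DIM('a) * real_of_int (m - k)))"
proof -
  have "measure lebesgue (ball (0::'a) (2 powi j)) = unit_ball_vol DIM('a) * (2 powi j) ^ DIM('a)" for j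
    by (simp add: measure_def emeasure_ball)
  moreover have "unit_ball_vol (real DIM('a)) \<noteq> 0"
    using unit_ball_vol_pos[of "real DIM('a)"] by linarith
  moreover have "((2::real) powi k) ^ DIM('a) / (2 powi m) ^ DIM('a) = (2 powi (k - m)) ^ DIM('a)"
    by (simp add: power_int_diff power_divide)
  moreover have "((2::real) powi (k - m)) ^ DIM('a) = 2 powr (- (real DIM('a) * real_of_int (m - k)))"
    using powr_real_of_int'[of 2 "k - m"] powr_power[where z = "2::real" and n = "DIM('a)" and u = "real_of_int (k - m)"]
    by (simp add: algebra_simps)
  ultimately show ?thesis by simp
qed

lemma is_delta_dyadic_balls:
  fixes N :: "('a::euclidean_space \<Rightarrow> complex) \<Rightarrow> ennreal"
  assumes "is_delta N \<delta>"
  obtains C where "0 < C"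
    "\<And>k m. k \<le> m \<Longrightarrow> N (indicator (ball 0 (2 powi k))) \<le>
      ennreal (C * 2 powr (- (real DIM('a) * \<delta> * real_of_int (m - k)))) * N (indicator (ball 0 (2 powi m)))"
proof -
  obtain C where C: "0 < C" "\<And>z r E. 0 < r \<Longrightarrow> E \<in> sets lebesgue \<Longrightarrow> E \<subseteq> ball z r \<Longrightarrow>
        N (indicator E) / N (indicator (ball z r)) \<le>
        ennreal (C * (measure lebesgue E / measure lebesgue (ball z r)) powr \<delta>)"
    using assms unfolding is_delta_def by blast
  show thesis
  proof (rule that[OF C(1)])
    fix k m :: int assume "k \<le> m"
    then have "ball (0::'a) (2 powi k) \<subseteq> ball 0 (2 powi m)"
      by (intro subset_ball power_int_increasing) auto
    from C(2)[OF _ _ this]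
    have "N (indicator (ball 0 (2 powi k))) / N (indicator (ball 0 (2 powi m)))
        \<le> ennreal (C * (2 powr (- (real DIM('a) * real_of_int (m - k)))) powr \<delta>)"
      unfolding measure_dyadic_ball_ratio by simp
    also have "(2 powr (- (real DIM('a) * real_of_int (m - k)))) powr \<delta>
        = 2 powr (- (real DIM('a) * \<delta> * real_of_int (m - k)))"
      by (simp only: powr_powr) (simp add: algebra_simps)
    finally show "N (indicator (ball 0 (2 powi k))) \<le>
      ennreal (C * 2 powr (- (real DIM('a) * \<delta> * real_of_int (m - k)))) * N (indicator (ball 0 (2 powi m)))"
      using C(1) by (intro ennreal_le_mult_of_divide_le) auto
  qed
qed

context ball_banach_space
begin

lemma zero_norm_imp_zero_integral:
  assumes [measurable]: "f \<in> borel_measurable lebesgue" and "N f = 0"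
  shows "(\<integral>\<^sup>+x. ennreal (norm (g x * f x)) \<partial>lebesgue) = 0"
proof -
  have "AE x in lebesgue. f x = 0" using assms by (intro definite) auto
  then have "AE x in lebesgue. ennreal (norm (g x * f x)) = 0"
    by eventually_elim simp
  then show ?thesis
    using nn_integral_cong_AE by fastforce
qed

text \<open>
  Normalising \<open>f\<close> gives a competitor in the supremum that defines the associate norm. If the
  norm of \<open>f\<close> vanishes, normalisation is impossible, but then \<open>f = 0\<close> almost everywhere.
\<close>
lemma hoelder:
  assumes f: "f \<in> fspace N" and [measurable]: "g \<in> borel_measurable lebesgue"
  shows "(\<integral>\<^sup>+x. ennreal (norm (g x * f x)) \<partial>lebesgue) \<le> N f * assoc N g"
proof (cases "N f = 0")
  case True
  then show ?thesis using f by (simp add: zero_norm_imp_zero_integral fspace_def)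
next
  case False
  have [measurable]: "f \<in> borel_measurable lebesgue" using f by (simp add: fspace_def)
  obtain t where t: "N f = ennreal t" "0 < t"
    using f False by (cases "N f") (auto simp: fspace_def less_le)
  let ?h = "\<lambda>x. complex_of_real (1 / t) * f x"
  have "N ?h = 1"
    using scale[OF f, of "complex_of_real (1 / t)"] t by (simp add: norm_divide flip: ennreal_mult)
  then have "(\<integral>\<^sup>+x. ennreal (norm (g x * ?h x)) \<partial>lebesgue) \<le> assoc N g"
    unfolding assoc_def by (intro SUP_upper) auto
  also have "(\<integral>\<^sup>+x. ennreal (norm (g x * ?h x)) \<partial>lebesgue)
      = (\<integral>\<^sup>+x. ennreal (1 / t) * ennreal (norm (g x * f x)) \<partial>lebesgue)"
    using t by (intro nn_integral_cong) (simp add: norm_mult norm_divide flip: ennreal_mult)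
  also have "\<dots> = ennreal (1 / t) * (\<integral>\<^sup>+x. ennreal (norm (g x * f x)) \<partial>lebesgue)"
    by (rule nn_integral_cmult) measurable
  finally have "N f * (ennreal (1 / t) * (\<integral>\<^sup>+x. ennreal (norm (g x * f x)) \<partial>lebesgue)) \<le> N f * assoc N g"
    by (rule mult_left_mono) simp
  then show ?thesis
    using t by (simp add: mult.assoc[symmetric] ennreal_mult[symmetric])
qed

text \<open>
  Between distant annuli the boundedness of the maximal operator enters through this inequality, the
  reverse of which, with constant \<open>1\<close>, is Hoelder's. If \<open>N g \<le> 1\<close>, the mean of \<open>\<bar>g\<bar>\<close>
  over the ball is a lower bound for the maximal
  function of \<open>g\<close> on the ball, so this mean times the norm of the indicator of the ball is at most
  \<open>C\<close>. The supremum over \<open>g\<close> yields the associate norm.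
\<close>
lemma ball_norm_mult_assoc_le:
  assumes "maximal_bounded_on (fspace N) N"
  obtains C where "0 < C" "\<And>z r. 0 < r \<Longrightarrow>
    N (indicator (ball z r)) * assoc N (indicator (ball z r)) \<le> ennreal C * emeasure lebesgue (ball z r)"
proof -
  obtain C where C: "0 < C" and M: "\<And>f. f \<in> fspace N \<Longrightarrow>
      (AE x in lebesgue. maximal f x < \<infinity>) \<and>
      N (\<lambda>x. complex_of_real (enn2real (maximal f x))) \<le> ennreal C * N f"
    using assms unfolding maximal_bounded_on_def by blast
  show thesis
  proof (rule that[OF C])
    fix z :: 'a and r :: real assume r: "0 < r"
    let ?B = "ball z r"
    define v where "v = unit_ball_vol DIM('a) * r ^ DIM('a)"
    have v: "0 < v" "emeasure lebesgue ?B = ennreal v"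
      using r by (auto simp: v_def emeasure_ball)
    have "N (indicator ?B) * (\<integral>\<^sup>+x. ennreal (norm (indicator ?B x * g x)) \<partial>lebesgue)
        \<le> ennreal C * ennreal v"
      if g [measurable]: "g \<in> borel_measurable lebesgue" and g1: "N g \<le> 1" for g
    proof -
      have gN: "g \<in> fspace N" using g g1 by (auto simp: fspace_def intro: le_less_trans)
      have I: "(\<integral>\<^sup>+x. ennreal (norm (indicator ?B x * g x)) \<partial>lebesgue)
          = (\<integral>\<^sup>+x\<in>?B. ennreal (norm (g x)) \<partial>lebesgue)"
        by (intro nn_integral_cong) (auto split: split_indicator)
      \<comment> \<open>The mean must be finite, because homogeneity of the norm is available for complex scalars only.\<close>
      obtain K where "(\<integral>\<^sup>+x\<in>?B. ennreal (norm (g x)) \<partial>lebesgue) \<le> ennreal K * N g"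
        using ball_integral[OF r] gN by blast
      also have "\<dots> < top"
        using gN by (auto simp: fspace_def ennreal_mult_less_top)
      finally obtain a where a: "0 \<le> a" "(\<integral>\<^sup>+x\<in>?B. ennreal (norm (g x)) \<partial>lebesgue) = ennreal a"
        by (cases "\<integral>\<^sup>+x\<in>?B. ennreal (norm (g x)) \<partial>lebesgue") auto
      have avg: "ennreal (a / v) \<le> maximal g x" if "x \<in> ?B" for x
        unfolding maximal_def using a v r that
        by (intro SUP_upper2[of "(z, r)"]) (simp_all add: divide_ennreal del: emeasure_completion)
      have "ennreal (a / v) * N (indicator ?B) = N (\<lambda>x. complex_of_real (a / v) * indicator ?B x)"
        using scale[OF ball_mem[OF r], of "complex_of_real (a / v)" z] a v by (simp add: norm_divide)
      also have "\<dots> \<le> N (\<lambda>x. complex_of_real (enn2real (maximal g x)))"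
      proof (intro lattice)
        show "AE x in lebesgue. norm (complex_of_real (a / v) * indicator ?B x)
            \<le> norm (complex_of_real (enn2real (maximal g x)))"
          using conjunct1[OF M[OF gN]]
        proof eventually_elim
          case (elim x)
          then show ?case
            using avg[of x] a v enn2real_mono[of "ennreal (a / v)" "maximal g x"]
            by (auto simp: indicator_def norm_divide)
        qed
      qed measurable
      also have "\<dots> \<le> ennreal C * N g" using M[OF gN] by simp
      also have "\<dots> \<le> ennreal C * 1" using g1 by (intro mult_left_mono) auto
      finally have "ennreal v * (ennreal (a / v) * N (indicator ?B)) \<le> ennreal v * (ennreal C * 1)"
        by (rule mult_left_mono) simp
      moreover have "ennreal v * ennreal (a / v) = ennreal a"
        using a v by (simp flip: ennreal_mult)
      ultimately show ?thesis
        unfolding I a(2) by (simp add: mult.assoc[symmetric] mult.commute)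
    qed
    then show "N (indicator ?B) * assoc N (indicator ?B) \<le> ennreal C * emeasure lebesgue ?B"
      unfolding v(2) assoc_def SUP_mult_left_ennreal by (intro SUP_least) auto
  qed
qed

end

section \<open>From one annulus to another\<close>

context ball_banach_space
begin

lemma annulus_local_estimate:
  assumes "maximal_bounded_on (fspace N) N"
  obtains C where "0 < C" "\<And>g k. g \<in> fspace N \<Longrightarrow>
    enorm N (\<lambda>x. maximal g x * indicator (annulus k) x) \<le> ennreal C * N g"
proof -
  obtain C where C: "0 < C" and M: "\<And>f. f \<in> fspace N \<Longrightarrow>
      (AE x in lebesgue. maximal f x < \<infinity>) \<and>
      N (\<lambda>x. complex_of_real (enn2real (maximal f x))) \<le> ennreal C * N f"
    using assms unfolding maximal_bounded_on_def by blast
  show thesis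
  proof (rule that[OF C])
    fix g k assume g: "g \<in> fspace N"
    have "enorm N (\<lambda>x. maximal g x * indicator (annulus k) x)
        \<le> N (\<lambda>x. complex_of_real (enn2real (maximal g x)))"
    proof (rule enorm_le)
      show "AE x in lebesgue. maximal g x * indicator (annulus k) x
          \<le> ennreal (norm (complex_of_real (enn2real (maximal g x))))"
        using conjunct1[OF M[OF g]] by eventually_elim (auto split: split_indicator)
    qed measurable
    also have "\<dots> \<le> ennreal C * N g" using M[OF g] by simp
    finally show "enorm N (\<lambda>x. maximal g x * indicator (annulus k) x) \<le> ennreal C * N g" .
  qed
qed

text \<open>
  On the annulus \<open>k\<close> the maximal function is at most a constant, so the norm of that annulus enters;
  the constant is an integral over the annulus \<open>l\<close>, divided by a volume, and Hoelder's inequality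
  estimates the integral by the associate norm of a ball.
\<close>
lemma annulus_separated_estimate:
  fixes f :: "'a \<Rightarrow> complex"
  defines "n \<equiv> DIM('a)"
  assumes kl: "2 \<le> \<bar>k - l\<bar>" and g: "restr (annulus l) f \<in> fspace N"
  shows "enorm N (\<lambda>x. maximal (restr (annulus l) f) x * indicator (annulus k) x) \<le>
    ennreal (8 ^ n) * N (restr (annulus l) f) *
      (N (indicator (ball 0 (2 powi k))) * assoc N (indicator (ball 0 (2 powi l)))
        / emeasure lebesgue (ball (0::'a) (2 powi max k l)))"
proof -
  let ?g = "restr (annulus l) f"
  let ?E = "emeasure lebesgue (ball (0::'a) (2 powi max k l))"
  let ?I = "\<integral>\<^sup>+y. ennreal (norm (?g y)) \<partial>lebesgue"
  have gB: "?g y = indicator (ball 0 (2 powi l)) y * ?g y" for y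
    using annulus_subset_ball[of l] by (auto simp: restr_def indicator_def)
  have I_set: "?I = (\<integral>\<^sup>+y\<in>ball 0 (2 powi l). ennreal (norm (?g y)) \<partial>lebesgue)"
    using annulus_subset_ball[of l] by (intro nn_integral_cong) (auto simp: restr_def indicator_def)
  obtain K where "?I \<le> ennreal K * N ?g"
    using ball_integral[of "2 powi l" 0] g unfolding I_set by auto
  also have "\<dots> < top"
    using g by (auto simp: fspace_def ennreal_mult_less_top)
  finally obtain i where i: "0 \<le> i" "?I = ennreal i"
    by (cases ?I) auto
  obtain e where e: "0 < e" "?E = ennreal e"
    by (rule that[of "unit_ball_vol DIM('a) * (2 powi max k l) ^ DIM('a)"]) (simp_all add: emeasure_ball)
  define a where "a = 8 ^ n * i / e"
  have a: "0 \<le> a" "ennreal (8 ^ n) * ?I / ?E = ennreal a"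
    using i e by (simp_all add: a_def divide_ennreal del: emeasure_completion flip: ennreal_mult)
  have "enorm N (\<lambda>x. maximal ?g x * indicator (annulus k) x)
      \<le> N (\<lambda>x. complex_of_real a * indicator (ball 0 (2 powi k)) x)"
  proof (intro enorm_le AE_I2)
    fix x
    show "maximal ?g x * indicator (annulus k) x
        \<le> ennreal (norm (complex_of_real a * indicator (ball 0 (2 powi k)) x))"
      using maximal_separated_annuli[of x k l f, OF _ kl] a annulus_subset_ball[of k]
      by (auto simp: n_def indicator_def norm_mult)
  qed measurable
  also have "\<dots> = ennreal a * N (indicator (ball 0 (2 powi k)))"
    using scale[OF ball_mem, of "2 powi k" "complex_of_real a" 0] a by simp
  also have "\<dots> = ennreal (8 ^ n) * ?I / ?E * N (indicator (ball 0 (2 powi k)))"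
    by (simp only: a)
  also have "\<dots> \<le> ennreal (8 ^ n) * (N ?g * assoc N (indicator (ball 0 (2 powi l)))) / ?E
      * N (indicator (ball 0 (2 powi k)))"
    using hoelder[OF g, of "indicator (ball 0 (2 powi l))"]
    by (intro mult_right_mono divide_right_mono_ennreal mult_left_mono) (simp_all flip: gB)
  finally show ?thesis
    by (simp only: divide_ennreal_def mult_ac)
qed

text \<open>
  The associate norm of the ball of index \<open>l\<close> (if \<open>l < k\<close>), or the norm of the ball of index
  \<open>k\<close> (if \<open>k < l\<close>), is compared with that of the larger ball. The product of the two norms of the
  larger ball is then absorbed by its volume, and a gain \<open>2 powr (- n * \<delta>X' * (k - l))\<close> or
  \<open>2 powr (- n * \<delta>X * (l - k))\<close> remains. The change of weight costs \<open>2 powr (\<alpha> * (k - l))\<close>. The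
  two conditions on \<open>\<alpha>\<close> say exactly that the gain wins on either side, with the margin \<open>\<epsilon>\<close>.
  For neighbouring annuli the boundedness of the maximal operator on the space suffices.
\<close>
lemma annulus_estimate:
  fixes \<alpha> \<delta>X \<delta>X' :: real
  defines "n \<equiv> real DIM('a)"
  assumes M: "maximal_bounded_on (fspace N) N"
    and dX: "is_delta N \<delta>X" and dX': "is_delta (assoc N) \<delta>X'"
    and \<alpha>: "- n * \<delta>X < \<alpha>" "\<alpha> < n * \<delta>X'"
  obtains D \<epsilon> where "0 < D" "0 < \<epsilon>" "\<And>f k l. restr (annulus l) f \<in> fspace N \<Longrightarrow>
    ennreal (2 powr (of_int k * \<alpha>)) * enorm N (\<lambda>x. maximal (restr (annulus l) f) x * indicator (annulus k) x)
    \<le> ennreal (D * 2 powr (- \<epsilon> * real_of_int \<bar>k - l\<bar>)) * (ennreal (2 powr (of_int l * \<alpha>)) * N (restr (annulus l) f))"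
proof -
  obtain C0 where C0: "0 < C0" and local: "\<And>g k. g \<in> fspace N \<Longrightarrow>
      enorm N (\<lambda>x. maximal g x * indicator (annulus k) x) \<le> ennreal C0 * N g"
    using annulus_local_estimate[OF M] by metis
  obtain C1 where C1: "0 < C1" and prod: "\<And>z r. 0 < r \<Longrightarrow>
      N (indicator (ball z r)) * assoc N (indicator (ball z r)) \<le> ennreal C1 * emeasure lebesgue (ball z r)"
    using ball_norm_mult_assoc_le[OF M] by metis
  obtain A where A: "0 < A" and X: "\<And>k m. k \<le> m \<Longrightarrow> N (indicator (ball 0 (2 powi k))) \<le>
      ennreal (A * 2 powr (- (n * \<delta>X * real_of_int (m - k)))) * N (indicator (ball 0 (2 powi m)))"
    using is_delta_dyadic_balls[OF dX] unfolding n_def by metis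
  obtain A' where A': "0 < A'" and X': "\<And>k m. k \<le> m \<Longrightarrow> assoc N (indicator (ball 0 (2 powi k))) \<le>
      ennreal (A' * 2 powr (- (n * \<delta>X' * real_of_int (m - k)))) * assoc N (indicator (ball 0 (2 powi m)))"
    using is_delta_dyadic_balls[OF dX'] unfolding n_def by metis
  define \<epsilon> where "\<epsilon> = min (n * \<delta>X' - \<alpha>) (n * \<delta>X + \<alpha>)"
  define D0 where "D0 = 8 ^ DIM('a) * C1 * max A A'"
  \<comment> \<open>The first entry covers neighbouring annuli: the weight changes by at most \<open>2 powr \<bar>\<alpha>\<bar>\<close>, and the factor \<open>2 powr \<epsilon>\<close> offsets the decay.\<close>
  define D where "D = max (C0 * 2 powr (\<bar>\<alpha>\<bar> + \<epsilon>)) D0"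
  have \<epsilon>: "0 < \<epsilon>" "\<epsilon> \<le> n * \<delta>X' - \<alpha>" "\<epsilon> \<le> n * \<delta>X + \<alpha>"
    using \<alpha> by (auto simp: \<epsilon>_def)
  have D0: "0 < D0" using C1 A by (simp add: D0_def)
  have D: "0 < D" "C0 * 2 powr (\<bar>\<alpha>\<bar> + \<epsilon>) \<le> D" "D0 \<le> D"
    using D0 by (auto simp: D_def)
  show thesis
  proof (rule that[OF D(1) \<epsilon>(1)])
    fix f :: "'a \<Rightarrow> complex" and k l :: int
    let ?g = "restr (annulus l) f"
    let ?T = "enorm N (\<lambda>x. maximal ?g x * indicator (annulus k) x)"
    assume g: "?g \<in> fspace N"
    let ?E = "emeasure lebesgue (ball (0::'a) (2 powi max k l))"
    have far: "?T \<le> ennreal (8 ^ DIM('a) * q) * N ?g"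
      if "2 \<le> \<bar>k - l\<bar>" "0 \<le> q"
        "N (indicator (ball 0 (2 powi k))) * assoc N (indicator (ball 0 (2 powi l))) \<le> ennreal q * ?E" for q
    proof -
      have "0 < ?E" "?E < top"
        by (simp_all add: emeasure_ball)
      then have "ennreal q * ?E / ?E = ennreal q"
        by (intro ennreal_mult_divide_eq) auto
      then have "N (indicator (ball 0 (2 powi k))) * assoc N (indicator (ball 0 (2 powi l))) / ?E \<le> ennreal q"
        using divide_right_mono_ennreal[OF that(3), of ?E] by simp
      then have "?T \<le> ennreal (8 ^ DIM('a)) * N ?g * ennreal q"
        by (intro order_trans[OF annulus_separated_estimate[OF that(1) g]] mult_left_mono) auto
      then show ?thesis
        using that by (simp add: ennreal_mult mult_ac)
    qed
    have prod': "N (indicator (ball 0 (2 powi max k l))) * assoc N (indicator (ball 0 (2 powi max k l))) \<le> ennreal C1 * ?E"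
      by (rule prod) simp
    have "\<exists>c\<ge>0. ?T \<le> ennreal c * N ?g \<and>
        2 powr (of_int k * \<alpha>) * c \<le> D * 2 powr (- \<epsilon> * real_of_int \<bar>k - l\<bar>) * 2 powr (of_int l * \<alpha>)"
    proof -
      consider "\<bar>k - l\<bar> \<le> 1" | "l + 2 \<le> k" | "k + 2 \<le> l" by linarith
      then show ?thesis
      proof cases
        case 1
        have "real_of_int (k - l) * \<alpha> \<le> \<bar>real_of_int (k - l)\<bar> * \<bar>\<alpha>\<bar>"
          by (metis abs_ge_self abs_mult)
        also have "\<dots> \<le> 1 * \<bar>\<alpha>\<bar>"
          using 1 by (intro mult_right_mono) auto
        finally have "of_int k * \<alpha> \<le> of_int l * \<alpha> + \<bar>\<alpha>\<bar>"
          by (simp add: algebra_simps)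
        moreover have "\<epsilon> * \<bar>real_of_int (k - l)\<bar> \<le> \<epsilon> * 1"
          using 1 \<epsilon> by (intro mult_left_mono) auto
        ultimately have "2 powr (of_int k * \<alpha>)
            \<le> 2 powr ((\<bar>\<alpha>\<bar> + \<epsilon>) + (- \<epsilon> * real_of_int \<bar>k - l\<bar>) + of_int l * \<alpha>)"
          by (intro powr_mono) auto
        then have "2 powr (of_int k * \<alpha>) * C0
            \<le> 2 powr ((\<bar>\<alpha>\<bar> + \<epsilon>) + (- \<epsilon> * real_of_int \<bar>k - l\<bar>) + of_int l * \<alpha>) * C0"
          using C0 by (intro mult_right_mono) auto
        also have "\<dots> = (C0 * 2 powr (\<bar>\<alpha>\<bar> + \<epsilon>)) * 2 powr (- \<epsilon> * real_of_int \<bar>k - l\<bar>) * 2 powr (of_int l * \<alpha>)"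
          by (simp only: powr_add mult_ac)
        also have "\<dots> \<le> D * 2 powr (- \<epsilon> * real_of_int \<bar>k - l\<bar>) * 2 powr (of_int l * \<alpha>)"
          using D by (intro mult_right_mono) auto
        finally show ?thesis
          using C0 local[OF g] by (intro exI[of _ C0]) auto
      next
        case 2
        define t where "t = 2 powr (- (n * \<delta>X' * real_of_int (k - l)))"
        have "N (indicator (ball 0 (2 powi k))) * assoc N (indicator (ball 0 (2 powi l)))
            \<le> N (indicator (ball 0 (2 powi k))) * (ennreal (A' * t) * assoc N (indicator (ball 0 (2 powi k))))"
          using X'[of l k] 2 unfolding t_def by (intro mult_left_mono) auto
        also have "\<dots> = ennreal (A' * t) *
            (N (indicator (ball 0 (2 powi k))) * assoc N (indicator (ball 0 (2 powi k))))"
          by (rule mult.left_commute)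
        also have "\<dots> \<le> ennreal (A' * t) * (ennreal C1 * ?E)"
          using prod' 2 by (intro mult_left_mono) (simp_all add: max_absorb1)
        also have "\<dots> = ennreal (A' * t * C1) * ?E"
          using A' C1 by (simp add: t_def ennreal_mult mult_ac)
        finally have T: "?T \<le> ennreal (8 ^ DIM('a) * (A' * t * C1)) * N ?g"
          using 2 A' C1 by (intro far) (auto simp: t_def)
        have "real_of_int (k - l) * \<epsilon> \<le> real_of_int (k - l) * (n * \<delta>X' - \<alpha>)"
          using 2 \<epsilon> by (intro mult_left_mono) auto
        then have "2 powr (of_int k * \<alpha> + - (n * \<delta>X' * real_of_int (k - l)))
            \<le> 2 powr (- \<epsilon> * real_of_int \<bar>k - l\<bar> + of_int l * \<alpha>)"
          using 2 by (intro powr_mono) (auto simp: algebra_simps)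
        moreover have "8 ^ DIM('a) * (A' * C1) \<le> D"
          using C1 by (intro order_trans[OF _ D(3)]) (simp add: D0_def mult.commute mult_left_mono)
        ultimately have "(8 ^ DIM('a) * (A' * C1)) * 2 powr (of_int k * \<alpha> + - (n * \<delta>X' * real_of_int (k - l)))
            \<le> D * 2 powr (- \<epsilon> * real_of_int \<bar>k - l\<bar> + of_int l * \<alpha>)"
          using D by (intro mult_mono) auto
        then have "2 powr (of_int k * \<alpha>) * (8 ^ DIM('a) * (A' * t * C1))
            \<le> D * 2 powr (- \<epsilon> * real_of_int \<bar>k - l\<bar>) * 2 powr (of_int l * \<alpha>)"
          unfolding t_def powr_add by (simp only: mult_ac)
        then show ?thesis
          using T A' C1 by (intro exI[of _ "8 ^ DIM('a) * (A' * t * C1)"]) (auto simp: t_def)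
      next
        case 3
        define t where "t = 2 powr (- (n * \<delta>X * real_of_int (l - k)))"
        have "N (indicator (ball 0 (2 powi k))) * assoc N (indicator (ball 0 (2 powi l)))
            \<le> (ennreal (A * t) * N (indicator (ball 0 (2 powi l)))) * assoc N (indicator (ball 0 (2 powi l)))"
          using X[of k l] 3 unfolding t_def by (intro mult_right_mono) auto
        also have "\<dots> = ennreal (A * t) *
            (N (indicator (ball 0 (2 powi l))) * assoc N (indicator (ball 0 (2 powi l))))"
          by (rule mult.assoc)
        also have "\<dots> \<le> ennreal (A * t) * (ennreal C1 * ?E)"
          using prod' 3 by (intro mult_left_mono) (simp_all add: max_absorb2)
        also have "\<dots> = ennreal (A * t * C1) * ?E"
          using A C1 by (simp add: t_def ennreal_mult mult_ac)
        finally have T: "?T \<le> ennreal (8 ^ DIM('a) * (A * t * C1)) * N ?g"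
          using 3 A C1 by (intro far) (auto simp: t_def)
        have "real_of_int (l - k) * \<epsilon> \<le> real_of_int (l - k) * (n * \<delta>X + \<alpha>)"
          using 3 \<epsilon> by (intro mult_left_mono) auto
        then have "2 powr (of_int k * \<alpha> + - (n * \<delta>X * real_of_int (l - k)))
            \<le> 2 powr (- \<epsilon> * real_of_int \<bar>k - l\<bar> + of_int l * \<alpha>)"
          using 3 by (intro powr_mono) (auto simp: algebra_simps)
        moreover have "8 ^ DIM('a) * (A * C1) \<le> D"
          using C1 by (intro order_trans[OF _ D(3)]) (simp add: D0_def mult.commute mult_left_mono)
        ultimately have "(8 ^ DIM('a) * (A * C1)) * 2 powr (of_int k * \<alpha> + - (n * \<delta>X * real_of_int (l - k)))
            \<le> D * 2 powr (- \<epsilon> * real_of_int \<bar>k - l\<bar> + of_int l * \<alpha>)"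
          using D by (intro mult_mono) auto
        then have "2 powr (of_int k * \<alpha>) * (8 ^ DIM('a) * (A * t * C1))
            \<le> D * 2 powr (- \<epsilon> * real_of_int \<bar>k - l\<bar>) * 2 powr (of_int l * \<alpha>)"
          unfolding t_def powr_add by (simp only: mult_ac)
        then show ?thesis
          using T A C1 by (intro exI[of _ "8 ^ DIM('a) * (A * t * C1)"]) (auto simp: t_def)
      qed
    qed
    then obtain c where c: "0 \<le> c" "?T \<le> ennreal c * N ?g"
        "2 powr (of_int k * \<alpha>) * c \<le> D * 2 powr (- \<epsilon> * real_of_int \<bar>k - l\<bar>) * 2 powr (of_int l * \<alpha>)"
      by blast
    have "ennreal (2 powr (of_int k * \<alpha>)) * ?T \<le> ennreal (2 powr (of_int k * \<alpha>)) * (ennreal c * N ?g)"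
      using c(2) by (rule mult_left_mono) simp
    also have "\<dots> = ennreal (2 powr (of_int k * \<alpha>) * c) * N ?g"
      using c(1) by (simp add: ennreal_mult mult.assoc)
    also have "\<dots> \<le> ennreal (D * 2 powr (- \<epsilon> * real_of_int \<bar>k - l\<bar>) * 2 powr (of_int l * \<alpha>)) * N ?g"
      using c(3) by (intro mult_right_mono ennreal_leI) auto
    also have "\<dots> = ennreal (D * 2 powr (- \<epsilon> * real_of_int \<bar>k - l\<bar>)) * (ennreal (2 powr (of_int l * \<alpha>)) * N ?g)"
      using D by (simp add: ennreal_mult mult.assoc)
    finally show "ennreal (2 powr (of_int k * \<alpha>)) * ?T \<le>
        ennreal (D * 2 powr (- \<epsilon> * real_of_int \<bar>k - l\<bar>)) * (ennreal (2 powr (of_int l * \<alpha>)) * N ?g)" .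
  qed
qed
end

section \<open>Herz spaces\<close>

lemma herz_norm_eq:
  "herz_norm \<alpha> p N f = ennpowr
     (\<integral>\<^sup>+k. ennpowr (ennreal (2 powr (of_int k * \<alpha>)) * N (restr (annulus k) f)) p \<partial>count_space UNIV) (1 / p)"
proof -
  have "2 powr (of_int k * p * \<alpha>) = (2 powr (of_int k * \<alpha>)) powr p" for k
    by (simp add: powr_powr mult_ac)
  then show ?thesis
    by (simp add: herz_norm_def infsum_int_eq_nn_integral ennpowr_cmult)
qed

lemma herz_norm_finite_imp_annulus_finite:
  assumes "herz_norm \<alpha> p N f < top"
  shows "N (restr (annulus k) f) < top"
proof -
  let ?u = "\<lambda>k. ennpowr (ennreal (2 powr (of_int k * \<alpha>)) * N (restr (annulus k) f)) p"
  have "(\<integral>\<^sup>+k. ?u k \<partial>count_space UNIV) < top"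
    using assms by (simp add: herz_norm_eq ennpowr_less_top_iff)
  then have "?u k < top"
    by (rule le_less_trans[OF le_nn_integral_int])
  then show ?thesis
    by (auto simp: ennpowr_less_top_iff ennreal_mult_less_top)
qed

text \<open>
  A compact set that avoids the origin stays away from the origin and from infinity.
\<close>
lemma compact_subset_finite_annuli:
  fixes F :: "'a::euclidean_space set"
  assumes "compact F" "F \<subseteq> - {0}"
  obtains K where "finite K" "F \<subseteq> (\<Union>k\<in>K. annulus k)"
proof -
  obtain a where a: "0 < a" "\<And>x. x \<in> F \<Longrightarrow> a \<le> norm x"
    using separate_point_closed[of F 0] assms by (force simp: compact_imp_closed dist_norm)
  obtain b where b: "0 < b" "\<And>x. x \<in> F \<Longrightarrow> norm x \<le> b"
    using assms(1) compact_imp_bounded bounded_pos by metis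
  let ?K = "{\<lfloor>log 2 a\<rfloor>..\<lceil>log 2 b\<rceil> + 1}"
  have "\<exists>k\<in>?K. x \<in> annulus k" if "x \<in> F" for x
  proof -
    have "x \<noteq> 0" using that assms by auto
    then obtain k where k: "x \<in> annulus k" by (rule annulus_exhausts)
    have "2 powr (real_of_int k - 1) \<le> b" "a < 2 powr real_of_int k"
      using k a(2)[OF that] b(2)[OF that] powr_real_of_int'[of 2 k] powr_real_of_int'[of 2 "k - 1"]
      by (auto simp: mem_annulus_iff)
    then have "real_of_int k - 1 \<le> log 2 b" "log 2 a < real_of_int k"
      using a(1) b(1) by (auto simp: le_log_iff log_less_iff)
    then have "k \<in> ?K" by simp linarith
    with k show ?thesis by blast
  qed
  then show ?thesis by (intro that[of ?K]) auto
qed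

context ball_banach_space
begin

lemma restr_Un_le:
  assumes [measurable]: "f \<in> borel_measurable lebesgue" "A \<in> sets lebesgue" "B \<in> sets lebesgue"
  shows "N (restr (A \<union> B) f) \<le> N (restr A f) + N (restr B f)"
proof -
  have "restr (A \<union> B) f = (\<lambda>x. restr A f x + restr (B - A) f x)"
    by (auto simp: restr_def indicator_def)
  then have "N (restr (A \<union> B) f) \<le> N (restr A f) + N (restr (B - A) f)"
    by (simp add: triangle_measurable)
  also have "N (restr (B - A) f) \<le> N (restr B f)"
    by (intro lattice AE_I2) (auto simp: restr_def indicator_def)
  finally show ?thesis by (simp add: add_left_mono)
qed

lemma restr_finite_UN_finite:
  assumes "finite K" and f [measurable]: "f \<in> borel_measurable lebesgue"
    and [measurable]: "\<And>k. A k \<in> sets lebesgue" and fin: "\<And>k. N (restr (A k) f) < top"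
  shows "N (restr (\<Union>k\<in>K. A k) f) < top"
  using assms(1)
proof induction
  case empty
  show ?case by (simp add: restr_def zero_norm)
next
  case (insert k K)
  have "N (restr (A k \<union> (\<Union>k\<in>K. A k)) f) \<le> N (restr (A k) f) + N (restr (\<Union>k\<in>K. A k) f)"
    using insert(1) by (intro restr_Un_le f sets.finite_UN) auto
  also have "\<dots> < top" using insert fin by simp
  finally show ?case by simp
qed

lemma fspace_locI:
  assumes f [measurable]: "f \<in> borel_measurable lebesgue"
    and fin: "\<And>k. N (restr (annulus k) f) < top"
  shows "f \<in> fspace_loc N"
proof -
  have "restr F f \<in> fspace N" if F: "compact F" "F \<subseteq> - {0}" for F
  proof -
    have [measurable]: "F \<in> sets lebesgue"
      using borel_compact[OF F(1)] by simp
    obtain K where K: "finite K" "F \<subseteq> (\<Union>k\<in>K. annulus k)"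
      using compact_subset_finite_annuli[OF F] .
    have [measurable]: "(\<Union>k\<in>K. annulus k) \<in> sets lebesgue"
      using K by (intro sets.finite_UN) auto
    have "N (restr F f) \<le> N (restr (\<Union>k\<in>K. annulus k) f)"
      using K by (intro lattice AE_I2) (auto simp: restr_def indicator_def)
    also have "\<dots> < top"
      using K fin by (intro restr_finite_UN_finite) auto
    finally show ?thesis by (simp add: fspace_def)
  qed
  then show ?thesis by (simp add: fspace_loc_def)
qed

text \<open>
  The weighted norms of the maximal function on the annuli are dominated by a convolution of the
  weighted norms of the pieces of \<open>f\<close> with an exponentially decaying kernel. The extended norms come
  first: they are finite on every annulus, so the maximal function is finite almost everywhere,
  and it belongs to the local space.
\<close>
lemma maximal_bounded_on_herz_space:
  fixes \<alpha> p \<delta>X \<delta>X' :: real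
  assumes p: "0 < p"
    and M: "maximal_bounded_on (fspace N) N"
    and dX: "is_delta N \<delta>X" and dX': "is_delta (assoc N) \<delta>X'"
    and \<alpha>: "- real DIM('a) * \<delta>X < \<alpha>" "\<alpha> < real DIM('a) * \<delta>X'"
  shows "maximal_bounded_on (herz_space \<alpha> p N) (herz_norm \<alpha> p N)"
proof -
  let ?w = "\<lambda>k::int. ennreal (2 powr (of_int k * \<alpha>))"
  obtain D \<epsilon> where D: "0 < D" and \<epsilon>: "0 < \<epsilon>" and est: "\<And>f k l. restr (annulus l) f \<in> fspace N \<Longrightarrow>
    ?w k * enorm N (\<lambda>x. maximal (restr (annulus l) f) x * indicator (annulus k) x)
    \<le> ennreal (D * 2 powr (- \<epsilon> * real_of_int \<bar>k - l\<bar>)) * (?w l * N (restr (annulus l) f))"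
    by (rule annulus_estimate[OF M dX dX' \<alpha>], rule that)
  obtain C where C: "0 < C" and conv:
    "\<And>a c. \<forall>k. a k \<le> (\<integral>\<^sup>+l. ennreal (D * 2 powr (- \<epsilon> * real_of_int \<bar>k - l\<bar>)) * c l \<partial>count_space UNIV) \<Longrightarrow>
      (\<integral>\<^sup>+k. ennpowr (a k) p \<partial>count_space (UNIV::int set))
        \<le> ennreal C * (\<integral>\<^sup>+l. ennpowr (c l) p \<partial>count_space UNIV)"
    by (rule exp_decay_convolution[OF p \<epsilon> D], rule that)
  have main: "(AE x in lebesgue. maximal f x < top) \<and>
      (\<lambda>x. complex_of_real (enn2real (maximal f x))) \<in> herz_space \<alpha> p N \<and>
      herz_norm \<alpha> p N (\<lambda>x. complex_of_real (enn2real (maximal f x))) \<le> ennreal (C powr (1 / p)) * herz_norm \<alpha> p N f"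
    if f: "f \<in> herz_space \<alpha> p N" for f
  proof -
    let ?h = "\<lambda>x. complex_of_real (enn2real (maximal f x))"
    let ?g = "\<lambda>l. restr (annulus l) f"
    let ?T = "\<lambda>k. enorm N (\<lambda>x. maximal f x * indicator (annulus k) x)"
    have [measurable]: "f \<in> borel_measurable lebesgue" and fin: "herz_norm \<alpha> p N f < top"
      using f by (auto simp: herz_space_def fspace_loc_def)
    have g: "?g l \<in> fspace N" for l
      using herz_norm_finite_imp_annulus_finite[OF fin] by (simp add: fspace_def)
    have "?w k * ?T k \<le> (\<integral>\<^sup>+l. ennreal (D * 2 powr (- \<epsilon> * real_of_int \<bar>k - l\<bar>)) * (?w l * N (?g l)) \<partial>count_space UNIV)" for k
    proof -
      have "?T k \<le> enorm N (\<lambda>x. \<integral>\<^sup>+l. maximal (?g l) x * indicator (annulus k) x \<partial>count_space UNIV)"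
      proof (intro enorm_mono AE_I2)
        fix x
        show "maximal f x * indicator (annulus k) x
            \<le> (\<integral>\<^sup>+l. maximal (?g l) x * indicator (annulus k) x \<partial>count_space UNIV)"
          by (simp add: nn_integral_multc mult_right_mono maximal_le_sum_annuli)
      qed (simp_all add: nn_integral_int_eq_suminf)
      also have "\<dots> \<le> (\<integral>\<^sup>+l. enorm N (\<lambda>x. maximal (?g l) x * indicator (annulus k) x) \<partial>count_space UNIV)"
        by (intro enorm_nn_integral_int) measurable
      finally have "?w k * ?T k \<le> ?w k * \<dots>"
        by (rule mult_left_mono) simp
      also have "\<dots> = (\<integral>\<^sup>+l. ?w k * enorm N (\<lambda>x. maximal (?g l) x * indicator (annulus k) x) \<partial>count_space UNIV)"
        by (rule nn_integral_cmult[symmetric]) simp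
      also have "\<dots> \<le> (\<integral>\<^sup>+l. ennreal (D * 2 powr (- \<epsilon> * real_of_int \<bar>k - l\<bar>)) * (?w l * N (?g l)) \<partial>count_space UNIV)"
        by (intro nn_integral_mono est g)
      finally show ?thesis .
    qed
    from conv[OF allI[OF this]]
    have sum: "(\<integral>\<^sup>+k. ennpowr (?w k * ?T k) p \<partial>count_space UNIV)
        \<le> ennreal C * (\<integral>\<^sup>+l. ennpowr (?w l * N (?g l)) p \<partial>count_space UNIV)" .
    have hT: "N (restr (annulus k) ?h) \<le> ?T k" for k
    proof -
      have "restr (annulus k) ?h = (\<lambda>x. complex_of_real (enn2real (maximal f x * indicator (annulus k) x)))"
        by (auto simp: restr_def indicator_def)
      then show ?thesis
        using norm_enn2real_le_enorm[of "\<lambda>x. maximal f x * indicator (annulus k) x"] by simp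
    qed
    have T_bound: "ennpowr (\<integral>\<^sup>+k. ennpowr (?w k * ?T k) p \<partial>count_space UNIV) (1 / p)
        \<le> ennreal (C powr (1 / p)) * herz_norm \<alpha> p N f"
      using ennpowr_mono[OF _ sum, of "1 / p"] p C by (simp add: herz_norm_eq ennpowr_cmult)
    also have "\<dots> < top"
      using fin by (simp add: ennreal_mult_less_top)
    finally have "(\<integral>\<^sup>+k. ennpowr (?w k * ?T k) p \<partial>count_space UNIV) < top"
      by (simp add: ennpowr_less_top_iff)
    then have pow_fin: "ennpowr (?w k * ?T k) p < top" for k
      by (rule le_less_trans[OF le_nn_integral_int])
    have Tfin: "?T k < top" for k
      using pow_fin[of k] by (auto simp: ennpowr_less_top_iff ennreal_mult_less_top)
    have "AE x in lebesgue. \<forall>k. maximal f x * indicator (annulus k) x < top"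
      unfolding AE_all_countable using Tfin by (intro allI enorm_finite_imp_AE_finite) auto
    then have AE: "AE x in lebesgue. maximal f x < top"
      using AE_lebesgue_neq_0
    proof eventually_elim
      case (elim x)
      obtain k where "x \<in> annulus k" using annulus_exhausts[OF elim(2)] .
      then show ?case using elim(1) by (auto dest: spec[of _ k])
    qed
    have h_loc: "?h \<in> fspace_loc N"
      using le_less_trans[OF hT Tfin] by (intro fspace_locI) auto
    have "herz_norm \<alpha> p N ?h \<le> ennpowr (\<integral>\<^sup>+k. ennpowr (?w k * ?T k) p \<partial>count_space UNIV) (1 / p)"
      unfolding herz_norm_eq using p
      by (intro ennpowr_mono nn_integral_mono mult_left_mono hT) auto
    also note T_bound
    finally have bound: "herz_norm \<alpha> p N ?h \<le> ennreal (C powr (1 / p)) * herz_norm \<alpha> p N f" .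
    also have "\<dots> < top" using fin by (simp add: ennreal_mult_less_top)
    finally show ?thesis using AE h_loc bound by (simp add: herz_space_def)
  qed
  show ?thesis
    unfolding maximal_bounded_on_def using C main by (intro exI[of _ "C powr (1 / p)"]) auto
qed

end

theorem theorem3p3:
  fixes \<alpha> p \<delta>X \<delta>X' :: real
    and N :: "(real ^ 'n \<Rightarrow> complex) \<Rightarrow> ennreal"
  assumes "0 < p"
    and "ball_banach_space N"
    and "assoc_eq_dual N"
    and "maximal_bounded_on (fspace N) N"
    and "is_delta N \<delta>X"
    and "is_delta (assoc N) \<delta>X'"
    and "- real CARD('n) * \<delta>X < \<alpha>"
    and "\<alpha> < real CARD('n) * \<delta>X'"
  shows "maximal_bounded_on (herz_space \<alpha> p N) (herz_norm \<alpha> p N)"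
  using ball_banach_space.maximal_bounded_on_herz_space[OF assms(2,1,4,5,6)] assms(7,8) by simp

end
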